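(* Let $p\in[2,\infty)$. $(\mathscr{A}_1)$ Suppose $p$ is an even integer. Then there are constants $C(K,p)$ and $c(K,p)$ (for $K\ge1$), depending only on $K$ and $p$, with $$\lim_{K\to1^+}C(K,p)=\csc\left(\frac{\pi}{2p}\right)\quad\text{and}\quad \lim_{K\to1^+}c(K,p)=\cot\left(\frac{\pi}{2p}\right),$$ such that for every harmonic $K$-quasiregular mapping $f=u+iv$ in $\mathbb{D}$ with $u\in\mathbf{h}^p$ and $$\cos\big(p(\arg f(0)-\pi/2)\big)\le 0,$$ one has $$\|f\|_p\le C(K,p)\|u\|_p\quad\text{and}\quad \|v\|_p\le c(K,p)\|u\|_p.$$ $(\mathscr{A}_2)$ Suppose $p$ is not an even integer. Then the same conclusion as in $(\mathscr{A}_1)$ holds (existence of constants $C(K,p)$, $c(K,p)$ depending only on $K$ and $p$, with $\lim_{K\to1^+}C(K,p)=\csc(\pi/(2p))$ and $\lim_{K\to1^+}c(K,p)=\cot(\pi/(2p))$, such that $\|f\|_p\le C(K,p)\|u\|_p$ and $\|v\|_p\le c(K,p)\|u\|_p$) for every harmonic $K$-quasiregular mapping $f=u+iv$ in $\mathbb{D}$ with $u\in\mathbf{h}^p$ and $\cos(p(\arg f(0)-\pi/2))\le0$ that satisfies the additional assumption $$f(\mathbb{D})\subset D_p:=\left\{w\in\mathbb{D}:\ \arg w\in\left[-\frac{(p-1)\pi}{2p},\frac{(3p-1)\pi}{2p}\right]\right\}.$$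
   Context: $\mathbb{D}$ is the open unit disk in $\mathbb{C}$. For a complex-valued $f$ write $f_z=\frac12(f_x-if_y)$, $f_{\overline z}=\frac12(f_x+if_y)$, $\Lambda_f=|f_z|+|f_{\overline z}|$, and $J_f=|f_z|^2-|f_{\overline z}|^2$ (the Jacobian). For a constant $K\ge1$, a mapping $f:\mathbb{D}\to\mathbb{C}$ is $K$-quasiregular if (1) $f$ is absolutely continuous on lines with locally $L^2$-integrable partial derivatives ($ACL^2$) and $J_f\ge0$ a.e. in $\mathbb{D}$; and (2) $\Lambda_f^2\le KJ_f$ a.e. in $\mathbb{D}$. A harmonic $K$-quasiregular mapping is a complex-valued harmonic function on $\mathbb{D}$ that is $K$-quasiregular. Here $u=\mathrm{Re}\,f$, $v=\mathrm{Im}\,f$. $\|f\|_p=\sup_{r\in[0,1)}M_p(r,f)$ where $M_p(r,f)=\left(\frac1{2\pi}\int_0^{2\pi}|f(re^{i\theta})|^p\,d\theta\right)^{1/p}$, and $\mathbf{h}^p$ is the set of harmonic functions on $\mathbb{D}$ with $\|f\|_p<\infty$. In $(\mathscr{A}_2)$ the argument is taken with values in the interval appearing in the definition of $D_p$; in $(\mathscr{A}_1)$ the condition does not depend on the choice of the argument. *)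

theory Defs
  imports "HOL-Analysis.Analysis"
begin

definition dx :: "(complex \<Rightarrow> 'a::real_normed_vector) \<Rightarrow> complex \<Rightarrow> 'a" where
  "dx f z = vector_derivative (\<lambda>t. f (z + of_real t)) (at 0)"

definition dy :: "(complex \<Rightarrow> 'a::real_normed_vector) \<Rightarrow> complex \<Rightarrow> 'a" where
  "dy f z = vector_derivative (\<lambda>t. f (z + \<i> * of_real t)) (at 0)"

text \<open>For open \<open>S\<close>, existence and continuity of both partial derivatives on \<open>S\<close> is the same as
  real continuous differentiability on \<open>S\<close>.\<close>

definition C1_on :: "complex set \<Rightarrow> (complex \<Rightarrow> 'a::real_normed_vector) \<Rightarrow> bool" where
  "C1_on S f \<longleftrightarrow>
     (\<forall>z\<in>S. (\<lambda>t::real. f (z + of_real t)) differentiable (at 0) \<and>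
            (\<lambda>t::real. f (z + \<i> * of_real t)) differentiable (at 0)) \<and>
     continuous_on S (dx f) \<and> continuous_on S (dy f)"

definition harmonic_on :: "complex set \<Rightarrow> (complex \<Rightarrow> 'a::real_normed_vector) \<Rightarrow> bool" where
  "harmonic_on S f \<longleftrightarrow>
     C1_on S f \<and> C1_on S (dx f) \<and> C1_on S (dy f) \<and>
     (\<forall>z\<in>S. dx (dx f) z + dy (dy f) z = 0)"

definition dz :: "(complex \<Rightarrow> complex) \<Rightarrow> complex \<Rightarrow> complex" where
  "dz f z = (dx f z - \<i> * dy f z) / 2"

definition dzbar :: "(complex \<Rightarrow> complex) \<Rightarrow> complex \<Rightarrow> complex" where
  "dzbar f z = (dx f z + \<i> * dy f z) / 2"

definition Lambda :: "(complex \<Rightarrow> complex) \<Rightarrow> complex \<Rightarrow> real" where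
  "Lambda f z = cmod (dz f z) + cmod (dzbar f z)"

definition Jac :: "(complex \<Rightarrow> complex) \<Rightarrow> complex \<Rightarrow> real" where
  "Jac f z = (cmod (dz f z))\<^sup>2 - (cmod (dzbar f z))\<^sup>2"

text \<open>Absolute continuity of a function on \<open>[a, b]\<close>; a pair \<open>(s, t)\<close> in \<open>P\<close> stands for the
  interval \<open>[s, t]\<close>, and the intervals of \<open>P\<close> do not overlap.\<close>

definition abs_cont_on_interval :: "real \<Rightarrow> real \<Rightarrow> (real \<Rightarrow> 'a::real_normed_vector) \<Rightarrow> bool" where
  "abs_cont_on_interval a b g \<longleftrightarrow>
     (\<forall>\<epsilon>>0. \<exists>\<delta>>0. \<forall>P :: (real \<times> real) set.
        finite P \<and> (\<forall>(s, t)\<in>P. a \<le> s \<and> s \<le> t \<and> t \<le> b) \<and>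
        disjoint_family_on (\<lambda>(s, t). {s<..<t}) P \<and>
        (\<Sum>(s, t)\<in>P. t - s) < \<delta>
        \<longrightarrow> (\<Sum>(s, t)\<in>P. norm (g t - g s)) < \<epsilon>)"

text \<open>On every closed rectangle contained in \<open>S\<close> with sides parallel to the axes, \<open>f\<close> is
  absolutely continuous on almost every horizontal and almost every vertical segment.\<close>

definition ACL_on :: "complex set \<Rightarrow> (complex \<Rightarrow> 'a::real_normed_vector) \<Rightarrow> bool" where
  "ACL_on S f \<longleftrightarrow>
     (\<forall>a b c d. a \<le> b \<and> c \<le> d \<and> cbox (Complex a c) (Complex b d) \<subseteq> S \<longrightarrow>
        (AE y in lebesgue. y \<in> {c..d} \<longrightarrow> abs_cont_on_interval a b (\<lambda>x. f (Complex x y))) \<and>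
        (AE x in lebesgue. x \<in> {a..b} \<longrightarrow> abs_cont_on_interval c d (\<lambda>y. f (Complex x y))))"

definition locally_L2_on :: "complex set \<Rightarrow> (complex \<Rightarrow> complex) \<Rightarrow> bool" where
  "locally_L2_on S g \<longleftrightarrow>
     (\<forall>T. compact T \<and> T \<subseteq> S \<longrightarrow>
        set_borel_measurable lebesgue T g \<and>
        set_integrable lebesgue T (\<lambda>z. (cmod (g z))\<^sup>2))"

definition ACL2_on :: "complex set \<Rightarrow> (complex \<Rightarrow> complex) \<Rightarrow> bool" where
  "ACL2_on S f \<longleftrightarrow> ACL_on S f \<and> locally_L2_on S (dx f) \<and> locally_L2_on S (dy f)"

definition quasiregular :: "real \<Rightarrow> (complex \<Rightarrow> complex) \<Rightarrow> bool" where
  "quasiregular K f \<longleftrightarrow>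
     ACL2_on (ball 0 1) f \<and>
     (AE z in lebesgue. z \<in> ball 0 1 \<longrightarrow> 0 \<le> Jac f z) \<and>
     (AE z in lebesgue. z \<in> ball 0 1 \<longrightarrow> (Lambda f z)\<^sup>2 \<le> K * Jac f z)"

definition harmonic_quasiregular :: "real \<Rightarrow> (complex \<Rightarrow> complex) \<Rightarrow> bool" where
  "harmonic_quasiregular K f \<longleftrightarrow> harmonic_on (ball 0 1) f \<and> quasiregular K f"

definition int_mean :: "real \<Rightarrow> real \<Rightarrow> (complex \<Rightarrow> 'a::real_normed_vector) \<Rightarrow> real" where
  "int_mean p r f =
     (1 / (2 * pi) * integral {0..2*pi} (\<lambda>\<theta>. norm (f (of_real r * cis \<theta>)) powr p)) powr (1 / p)"

text \<open>The supremum is taken in the extended reals, so that it is \<open>\<infinity>\<close> when the means are unbounded.\<close>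

definition hardy_norm :: "real \<Rightarrow> (complex \<Rightarrow> 'a::real_normed_vector) \<Rightarrow> ereal" where
  "hardy_norm p f = (SUP r\<in>{0..<1}. ereal (int_mean p r f))"

definition harmonic_hardy :: "real \<Rightarrow> (complex \<Rightarrow> 'a::real_normed_vector) set" where
  "harmonic_hardy p = {f. harmonic_on (ball 0 1) f \<and> hardy_norm p f < \<infinity>}"

definition arg_range :: "real \<Rightarrow> real set" where
  "arg_range p = {- ((p - 1) * pi / (2 * p)) .. (3 * p - 1) * pi / (2 * p)}"

text \<open>\<open>is_Arg w t\<close> says that \<open>t\<close> is a value of the argument of \<open>w\<close>; every real number is an argument
  of \<open>0\<close>, so \<open>0\<close> belongs to this set.\<close>

definition D_region :: "real \<Rightarrow> complex set" where
  "D_region p = {w \<in> ball 0 1. \<exists>t\<in>arg_range p. is_Arg w t}"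

end

theory Submission
  imports Defs "HOL-Computational_Algebra.Polynomial"
begin

text \<open>Put \<open>\<theta> = pi / (2 * p)\<close> and \<open>c = cot \<theta>\<close>. The hypotheses on \<open>f 0\<close> (and, for \<open>p\<close> not even, on
  the range of the argument) say that \<open>\<bar>Im (f 0)\<bar> \<le> c * \<bar>Re (f 0)\<bar>\<close>. The function
  \<open>\<bar>Im w\<bar> powr p - c powr p * \<bar>Re w\<bar> powr p\<close> has a superharmonic majorant \<open>F\<close>, the barrier: it is a
  multiple of \<open>\<bar>w\<bar> powr p * cos (p * s)\<close> in the cone where the angle \<open>s\<close> between \<open>w\<close> and the
  imaginary axis is at most \<open>\<theta>\<close>, and equals the minorant elsewhere, where it is nonpositive. For
  quasiregular \<open>f\<close> the function \<open>F \<circ> f\<close> is superharmonic after subtracting the small convex term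
  \<open>\<epsilon> * ((Im w)\<^sup>2 + L * (Re w)\<^sup>2) powr (p / 2)\<close> with \<open>\<epsilon> * L\<close> of order \<open>K\<^sup>2 - 1\<close>. Its circle means are
  thus bounded by its value at \<open>0\<close>, which is nonpositive, and this is the estimate of \<open>Im f\<close>. The
  estimate of \<open>f\<close> is Minkowski's inequality for \<open>(Re f)\<^sup>2 + (Im f)\<^sup>2\<close>.

  Superharmonicity is only needed pointwise, through the limes superior of the second-order
  difference quotients; the inequality for circle means then follows from the minimum principle
  by comparison with real parts of polynomials, which are dense on the circle.\<close>

text \<open>Up to the first sign change of its harmonic piece, at p * s = pi / 2, F lives exactly on
  the cone where the minorant is nonnegative; the one free constant is the multiple. Equality of
  first derivatives across the edge forces it to be \<open>cone_coeff p\<close>. F is then C1 but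
  not C2 at the edge, hence a notion of superharmonicity that only asks for a smooth function
  touching from above. Errors are proportional to K^2 - 1: for conformal f the gradients of Re f and
  Im f have equal length and (f_x)^2 + (f_y)^2 vanishes, and the dilatation controls both defects.
  The correction has two parameters because only \<epsilon> * L has to dominate the error, while
  \<epsilon> alone decides how much of the mean of \<bar>Im f\<bar> powr p is lost. In the limit
  Minkowski turns cot \<theta> into csc \<theta>, because 1 + (cot \<theta>)^2 = (csc
  \<theta>)^2.\<close>

subsection \<open>Discrete Laplacians and the minimum principle\<close>

text \<open>A derivative near 0 that is itself differentiable at 0 takes the place of a continuous
  second derivative. Harmonic maps supply it along both axes, and it suffices to bound symmetric
  second differences from above.\<close>

definition jet2 :: "(real \<Rightarrow> 'a::real_normed_vector) \<Rightarrow> 'a \<Rightarrow> 'a \<Rightarrow> bool" where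
  "jet2 \<phi> a b \<longleftrightarrow> (\<exists>\<phi>'. (\<forall>\<^sub>F t in nhds 0. (\<phi> has_vector_derivative \<phi>' t) (at t)) \<and>
      \<phi>' 0 = a \<and> (\<phi>' has_vector_derivative b) (at 0))"

lemma jet2_second_difference:
  fixes \<phi> :: "real \<Rightarrow> real"
  assumes "jet2 \<phi> a b" "0 < \<eta>"
  shows "\<forall>\<^sub>F t in at_right 0. \<phi> t + \<phi> (- t) - 2 * \<phi> 0 \<le> (b + \<eta>) * t\<^sup>2"
proof -
  obtain \<phi>' where d1: "\<forall>\<^sub>F t in nhds 0. (\<phi> has_vector_derivative \<phi>' t) (at t)"
    and a: "\<phi>' 0 = a" and d2: "(\<phi>' has_vector_derivative b) (at 0)"
    using assms by (auto simp: jet2_def)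
  obtain e1 where e1: "e1 > 0" "\<And>t. \<bar>t\<bar> < e1 \<Longrightarrow> (\<phi> has_real_derivative \<phi>' t) (at t)"
    using d1 unfolding eventually_nhds_metric
    by (auto simp: dist_real_def has_real_derivative_iff_has_vector_derivative)
  have "(\<phi>' has_derivative (\<lambda>t. t * b)) (at 0)"
    using d2 by (simp add: has_vector_derivative_def)
  then obtain e2 where e2: "e2 > 0"
      "\<And>t. \<bar>t\<bar> < e2 \<Longrightarrow> \<bar>\<phi>' t - a - t * b\<bar> \<le> \<eta> * \<bar>t\<bar>"
    unfolding has_derivative_at_alt using assms(2) a by auto
  define e where "e = min e1 e2"
  have "\<phi> t + \<phi> (- t) - 2 * \<phi> 0 \<le> (b + \<eta>) * t\<^sup>2" if t: "0 < t" "t < e" for t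
  proof -
    \<comment> \<open>\<open>\<psi>\<close> is nonincreasing on [0, t]: the linear expansion of
      \<open>\<phi>'\<close> at 0 gives
      \<open>\<phi>' x - \<phi>' (- x) \<le> (b + \<eta>) * (2 * x)\<close>.\<close>
    define \<psi> where "\<psi> x = \<phi> x + \<phi> (- x) - (b + \<eta>) * x\<^sup>2" for x
    have "\<psi> t \<le> \<psi> 0"
    proof (rule DERIV_nonpos_imp_nonincreasing[where f = \<psi>])
      fix x assume x: "0 \<le> x" "x \<le> t"
      have "((\<lambda>x. \<phi> (- x)) has_real_derivative (\<phi>' (- x) * - 1)) (at x)"
        by (rule DERIV_chain2[of \<phi>]) (use e1(2)[of "-x"] x t in \<open>auto simp: e_def intro!: derivative_eq_intros\<close>)
      then have "(\<psi> has_real_derivative (\<phi>' x - \<phi>' (- x) - (b + \<eta>) * (2 * x))) (at x)"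
        unfolding \<psi>_def using e1(2)[of x] x t
        by (auto simp: e_def intro!: derivative_eq_intros)
      moreover have "\<phi>' x - \<phi>' (- x) - (b + \<eta>) * (2 * x) \<le> 0"
        using e2(2)[of x] e2(2)[of "-x"] x t by (auto simp: e_def algebra_simps)
      ultimately show "\<exists>y. (\<psi> has_real_derivative y) (at x) \<and> y \<le> 0" by blast
    qed (use t in simp)
    then show ?thesis by (simp add: \<psi>_def)
  qed
  then show ?thesis
    unfolding eventually_at_right_field using e1(1) e2(1) by (auto simp: e_def intro!: exI[of _ e])
qed

definition discrete_laplacian :: "(complex \<Rightarrow> real) \<Rightarrow> complex \<Rightarrow> real \<Rightarrow> real" where
  "discrete_laplacian G z t =
     G (z + of_real t) + G (z - of_real t) + G (z + \<i> * of_real t) + G (z - \<i> * of_real t) - 4 * G z"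

text \<open>A bound for the limes superior of the five-point Laplacian divided by t^2. One-sided t
  loses nothing, as the stencil is even in t.\<close>

definition laplacian_le :: "(complex \<Rightarrow> real) \<Rightarrow> complex \<Rightarrow> real \<Rightarrow> bool" where
  "laplacian_le G z L \<longleftrightarrow>
     (\<forall>\<eta>>0. \<forall>\<^sub>F t in at_right 0. discrete_laplacian G z t \<le> (L + \<eta>) * t\<^sup>2)"

lemma laplacian_le_jet2:
  assumes "jet2 (\<lambda>t. G (z + of_real t)) a1 b1" "jet2 (\<lambda>t. G (z + \<i> * of_real t)) a2 b2"
  shows "laplacian_le G z (b1 + b2)"
  unfolding laplacian_le_def
proof (intro allI impI)
  fix \<eta> :: real assume "\<eta> > 0"
  then have *: "\<eta> / 2 > 0" by simp
  show "\<forall>\<^sub>F t in at_right 0. discrete_laplacian G z t \<le> (b1 + b2 + \<eta>) * t\<^sup>2"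
    using jet2_second_difference[OF assms(1) *] jet2_second_difference[OF assms(2) *]
    by eventually_elim (simp add: discrete_laplacian_def algebra_simps)
qed

lemma laplacian_le_mono:
  assumes "laplacian_le G z L" "L \<le> M"
  shows "laplacian_le G z M"
  unfolding laplacian_le_def
proof (intro allI impI)
  fix \<eta> :: real assume "\<eta> > 0"
  show "\<forall>\<^sub>F t in at_right 0. discrete_laplacian G z t \<le> (M + \<eta>) * t\<^sup>2"
    using assms(1)[unfolded laplacian_le_def, rule_format, OF \<open>\<eta> > 0\<close>]
    by (rule eventually_mono)
      (auto elim!: order_trans intro!: mult_right_mono simp: assms(2))
qed

lemma laplacian_le_add:
  assumes "laplacian_le G z L" "laplacian_le H z M"
  shows "laplacian_le (\<lambda>x. G x + H x) z (L + M)"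
  unfolding laplacian_le_def
proof (intro allI impI)
  fix \<eta> :: real assume "\<eta> > 0"
  then have *: "\<eta> / 2 > 0" by simp
  show "\<forall>\<^sub>F t in at_right 0. discrete_laplacian (\<lambda>x. G x + H x) z t \<le> (L + M + \<eta>) * t\<^sup>2"
    using assms(1)[unfolded laplacian_le_def, rule_format, OF *]
      assms(2)[unfolded laplacian_le_def, rule_format, OF *]
    by eventually_elim (simp add: discrete_laplacian_def algebra_simps)
qed

lemma tendsto_stencil:
  "((\<lambda>t. z + of_real t) \<longlongrightarrow> (z::complex)) (at_right 0)"
  "((\<lambda>t. z - of_real t) \<longlongrightarrow> (z::complex)) (at_right 0)"
  "((\<lambda>t. z + \<i> * of_real t) \<longlongrightarrow> (z::complex)) (at_right 0)"
  "((\<lambda>t. z - \<i> * of_real t) \<longlongrightarrow> (z::complex)) (at_right 0)"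
  by (auto intro!: tendsto_eq_intros)

lemma eventually_stencil:
  assumes "\<forall>\<^sub>F x in nhds z. P x"
  shows "\<forall>\<^sub>F t in at_right 0. P (z + of_real t) \<and> P (z - of_real t) \<and>
            P (z + \<i> * of_real t) \<and> P (z - \<i> * of_real t)"
  using tendsto_stencil[of z, THEN filterlim_iff[THEN iffD1], rule_format, OF assms]
  by (simp add: eventually_conj_iff)

text \<open>The centre values agree and the four neighbours only drop, so the stencil drops. This
  treats the edge of the cone, where the barrier has no Hessian.\<close>

lemma laplacian_le_touching:
  assumes "laplacian_le T z L" "\<forall>\<^sub>F x in nhds z. G x \<le> T x" "G z = T z"
  shows "laplacian_le G z L"
  unfolding laplacian_le_def
proof (intro allI impI)
  fix \<eta> :: real assume "\<eta> > 0"
  show "\<forall>\<^sub>F t in at_right 0. discrete_laplacian G z t \<le> (L + \<eta>) * t\<^sup>2"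
    using assms(1)[unfolded laplacian_le_def, rule_format, OF \<open>\<eta> > 0\<close>]
      eventually_stencil[OF assms(2)]
    by eventually_elim (use assms(3) in \<open>simp add: discrete_laplacian_def\<close>)
qed

lemma discrete_laplacian_norm_square: "discrete_laplacian (\<lambda>x. (cmod x)\<^sup>2) z t = 4 * t\<^sup>2"
  unfolding discrete_laplacian_def cmod_power2 by (simp add: power2_eq_square algebra_simps)

lemma laplacian_minimum_principle:
  assumes r: "0 \<le> r" and cont: "continuous_on (cball 0 r) G"
    and lap: "\<And>z. z \<in> ball 0 r \<Longrightarrow> laplacian_le G z 0"
    and bd: "\<And>z. z \<in> sphere 0 r \<Longrightarrow> 0 \<le> G z"
    and z: "z \<in> cball 0 r"
  shows "0 \<le> G z"
proof -
  \<comment> \<open>The perturbation lowers the stencil by 4 * \<epsilon> * t^2, more than the slack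
    \<epsilon> * t^2 allowed for G, so H has no interior minimum.\<close>
  have perturbed: "0 \<le> G z + \<epsilon> * (r\<^sup>2 - (cmod z)\<^sup>2)" if \<epsilon>: "\<epsilon> > 0" for \<epsilon>
  proof -
    define H where "H = (\<lambda>z. G z + \<epsilon> * (r\<^sup>2 - (cmod z)\<^sup>2))"
    have "continuous_on (cball 0 r) H"
      unfolding H_def by (intro continuous_intros cont)
    moreover have "cball (0::complex) r \<noteq> {}" using r by simp
    ultimately obtain m where m: "m \<in> cball 0 r" "\<And>y. y \<in> cball 0 r \<Longrightarrow> H m \<le> H y"
      using continuous_attains_inf[of "cball 0 r" H] by auto
    have "m \<notin> ball 0 r"
    proof
      assume mb: "m \<in> ball 0 r"
      then have "\<forall>\<^sub>F x in nhds m. x \<in> ball 0 r"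
        by (intro eventually_nhds_in_open) auto
      then have "\<forall>\<^sub>F x in nhds m. H m \<le> H x"
        by eventually_elim (use m in auto)
      note ev = eventually_stencil[OF this]
      have "\<forall>\<^sub>F t in at_right 0. discrete_laplacian G m t \<le> (0 + \<epsilon>) * t\<^sup>2"
        using lap[OF mb] \<epsilon> unfolding laplacian_le_def by blast
      with ev have "\<forall>\<^sub>F t in at_right 0. (0::real) \<ge> t\<^sup>2"
      proof eventually_elim
        case (elim t)
        have "0 \<le> discrete_laplacian H m t"
          using elim by (simp add: discrete_laplacian_def)
        also have "\<dots> = discrete_laplacian G m t - \<epsilon> * discrete_laplacian (\<lambda>x. (cmod x)\<^sup>2) m t"
          by (simp add: H_def discrete_laplacian_def algebra_simps)
        also have "\<dots> \<le> \<epsilon> * t\<^sup>2 - \<epsilon> * (4 * t\<^sup>2)"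
          using elim by (simp add: discrete_laplacian_norm_square)
        finally have "\<epsilon> * t\<^sup>2 \<le> 0" by simp
        then show ?case using \<epsilon> by (simp add: mult_le_0_iff)
      qed
      moreover have "\<forall>\<^sub>F t in at_right (0::real). t > 0"
        by (simp add: eventually_at_right_less)
      ultimately have "\<forall>\<^sub>F t in at_right (0::real). False"
        by eventually_elim auto
      then show False by simp
    qed
    then have "m \<in> sphere 0 r" using m(1) by auto
    then have "0 \<le> H m" using bd[of m] by (simp add: H_def)
    also have "\<dots> \<le> H z" using m(2) z by blast
    finally show ?thesis by (simp add: H_def)
  qed
  show ?thesis
  proof (rule ccontr)
    assume neg: "\<not> 0 \<le> G z"
    define A where "A = r\<^sup>2 - (cmod z)\<^sup>2"
    have A: "A \<ge> 0" using z by (simp add: A_def power_mono)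
    \<comment> \<open>A definite \<epsilon> replaces the limit: with denominator A + 1 the perturbed
      value is G z / (A + 1), which is still negative.\<close>
    have "0 \<le> G z + (- G z / (A + 1)) * A"
      using perturbed[of "- G z / (A + 1)"] neg A by (simp add: A_def[symmetric] divide_neg_pos)
    also have "\<dots> = G z / (A + 1)"
      using A by (simp add: field_simps)
    finally show False using neg A by (simp add: zero_le_divide_iff)
  qed
qed

subsection \<open>Circle means\<close>

lemma jet2I:
  assumes "\<And>t. (\<phi> has_vector_derivative \<phi>' t) (at t)" "(\<phi>' has_vector_derivative b) (at 0)"
  shows "jet2 \<phi> (\<phi>' 0) b"
  unfolding jet2_def using assms by (intro exI[of _ \<phi>']) simp

lemma poly_line_derivative:
  fixes P :: "complex poly"
  shows "((\<lambda>t. poly P (z + c * of_real t)) has_vector_derivative c * poly (pderiv P) (z + c * of_real t)) (at t)"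
proof -
  have "((\<lambda>t. z + c * of_real t) has_vector_derivative c) (at t)"
    by (auto intro!: derivative_eq_intros simp: has_vector_derivative_def scaleR_conv_of_real)
  from field_vector_diff_chain_at[OF this poly_DERIV] show ?thesis
    by (simp add: o_def)
qed

lemma jet2_Re_poly:
  fixes P :: "complex poly"
  shows "jet2 (\<lambda>t. Re (poly P (z + c * of_real t))) (Re (c * poly (pderiv P) z))
           (Re (c\<^sup>2 * poly (pderiv (pderiv P)) z))"
proof -
  have "((\<lambda>t. Re (c * poly (pderiv P) (z + c * of_real t))) has_vector_derivative
          Re (c * (c * poly (pderiv (pderiv P)) (z + c * of_real 0)))) (at 0)"
    by (intro bounded_linear.has_vector_derivative[OF bounded_linear_Re]
        has_vector_derivative_mult_right poly_line_derivative)
  then show ?thesis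
    using jet2I[OF bounded_linear.has_vector_derivative[OF bounded_linear_Re poly_line_derivative[of P z c]]]
    by (simp add: power2_eq_square mult.assoc)
qed

lemma laplacian_le_Re_poly: "laplacian_le (\<lambda>z. Re (poly P z)) z 0"
  using laplacian_le_jet2[of "\<lambda>z. Re (poly P z)" z] jet2_Re_poly[of P z 1] jet2_Re_poly[of P z \<i>]
  by fastforce

text \<open>Here \<open>0 ^ k\<close> is 1 for k = 0 and 0 otherwise, so that summing over the
  coefficients of a polynomial reassembles its value at 0.\<close>

lemma has_integral_circle_power:
  "((\<lambda>\<theta>. (of_real r * cis \<theta>) ^ k) has_integral 2 * pi * (0::complex) ^ k) {0..2*pi}"
proof (cases "k = 0")
  case True
  then show ?thesis
    using has_integral_const_real[of "1::complex" 0 "2*pi"] by (simp add: scaleR_conv_of_real)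
next
  case False
  define F where "F \<theta> = of_real r ^ k * cis (of_nat k * \<theta>) / (\<i> * of_nat k)" for \<theta>
  have "(F has_vector_derivative (of_real r * cis \<theta>) ^ k) (at \<theta> within S)" for \<theta> S
  proof -
    have "((\<lambda>z. of_real r ^ k * exp (\<i> * (of_nat k * z)) / (\<i> * of_nat k)) has_field_derivative
        (of_real r * cis \<theta>) ^ k) (at (of_real \<theta>))"
      using False
      by (auto intro!: derivative_eq_intros simp: power_mult_distrib cis_conv_exp)
        (simp add: exp_of_nat_mult[symmetric] algebra_simps)
    from has_vector_derivative_real_field[OF this, of S] show ?thesis
      by (simp add: o_def F_def[abs_def] cis_conv_exp)
  qed
  then have "((\<lambda>\<theta>. (of_real r * cis \<theta>) ^ k) has_integral (F (2*pi) - F 0)) {0..2*pi}"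
    by (intro fundamental_theorem_of_calculus) auto
  moreover have "cis (of_nat k * (2*pi)) = 1"
    by (metis cis_multiple_2pi Ints_of_nat mult.commute mult.assoc)
  ultimately show ?thesis using False by (simp add: F_def power_0_left)
qed

lemma has_integral_circle_poly:
  "((\<lambda>\<theta>. Re (poly P (of_real r * cis \<theta>))) has_integral 2 * pi * Re (poly P 0)) {0..2*pi}"
proof -
  have "((\<lambda>\<theta>. \<Sum>k\<le>degree P. coeff P k * (of_real r * cis \<theta>) ^ k) has_integral
         (\<Sum>k\<le>degree P. coeff P k * (2 * pi * (0::complex) ^ k))) {0..2*pi}"
    by (intro has_integral_sum finite_atMost has_integral_mult_right has_integral_circle_power)
  moreover have "(\<Sum>k\<le>degree P. coeff P k * (2 * pi * (0::complex) ^ k)) = 2 * pi * poly P 0"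
    unfolding poly_altdef[of P 0] sum_distrib_left by (rule sum.cong) auto
  ultimately have "((\<lambda>\<theta>. poly P (of_real r * cis \<theta>)) has_integral 2 * pi * poly P 0) {0..2*pi}"
    by (simp add: poly_altdef)
  from has_integral_linear[OF this bounded_linear_Re] show ?thesis by (simp add: o_def)
qed

text \<open>Real parts of polynomials are closed under multiplication on the circle, since there
  \<open>Re P * Re Q = Re (P * Q) / 2 + Re (P * cnj Q) / 2\<close>.\<close>

lemma circle_Re_poly_mult_cnj:
  "\<exists>R. \<forall>z\<in>sphere 0 r. Re (poly P z * cnj (poly Q z)) = Re (poly R z)"
proof (induction P arbitrary: Q)
  case 0
  then show ?case by (intro exI[of _ 0]) simp
next
  case (pCons a P)
  obtain b Q' where Q: "Q = pCons b Q'" by (cases Q)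
  obtain R where R: "\<And>z. z \<in> sphere 0 r \<Longrightarrow> Re (poly P z * cnj (poly Q' z)) = Re (poly R z)"
    using pCons.IH[of Q'] by blast
  \<comment> \<open>Expand (a + z * P) * cnj (b + z * Q'). Conjugation turns the mixed terms into
    real parts of polynomials, and z * cnj z = r^2 on the circle reduces the product P * cnj Q' to
    the induction hypothesis.\<close>
  show ?case
  proof (intro exI[of _ "[:a * cnj b:] + smult (cnj a) (pCons 0 Q') + smult (cnj b) (pCons 0 P)
      + smult (of_real (r\<^sup>2)) R"] ballI)
    fix z :: complex assume z: "z \<in> sphere 0 r"
    then have zz: "z * cnj z = of_real (r\<^sup>2)" by (simp add: complex_norm_square[symmetric])
    have "poly (pCons a P) z * cnj (poly Q z) = a * cnj b + cnj (cnj a * (z * poly Q' z))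
       + cnj b * (z * poly P z) + (z * cnj z) * (poly P z * cnj (poly Q' z))"
      by (simp add: Q algebra_simps)
    then have "Re (poly (pCons a P) z * cnj (poly Q z)) = Re (a * cnj b) + Re (cnj a * (z * poly Q' z))
       + Re (cnj b * (z * poly P z)) + r\<^sup>2 * Re (poly P z * cnj (poly Q' z))"
      unfolding zz
      by (simp only: plus_complex.sel cnj.sel scaleR_conv_of_real[symmetric] scaleR_complex.sel)
    then show "Re (poly (pCons a P) z * cnj (poly Q z)) = Re (poly ([:a * cnj b:] + smult (cnj a) (pCons 0 Q') + smult (cnj b) (pCons 0 P)
      + smult (of_real (r\<^sup>2)) R) z)"
      unfolding R[OF z] by (simp add: algebra_simps)
  qed
qed

lemma circle_approximation_Re_poly:
  assumes "continuous_on (sphere 0 r) g" "0 < e"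
  shows "\<exists>P. \<forall>z\<in>sphere 0 r. \<bar>g z - Re (poly P z)\<bar> < e"
proof -
  define H where "H = (\<lambda>g. \<exists>P. \<forall>z\<in>sphere 0 r. g z = Re (poly P z))"
  have "\<exists>g'. H g' \<and> (\<forall>z\<in>sphere 0 r. \<bar>g z - g' z\<bar> < e)"
  proof (rule Stone_Weierstrass_HOL[where P = H, OF _ _ _ _ _ _ assms])
    show "H (\<lambda>x. c)" for c
      unfolding H_def by (intro exI[of _ "[:of_real c:]"]) simp
    show "continuous_on (sphere 0 r) f" if "H f" for f
    proof -
      obtain P where "\<And>z. z \<in> sphere 0 r \<Longrightarrow> f z = Re (poly P z)" using \<open>H f\<close> unfolding H_def by blast
      moreover have "continuous_on (sphere 0 r) (\<lambda>z. Re (poly P z))" by (intro continuous_intros)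
      ultimately show ?thesis by (metis (no_types, lifting) continuous_on_cong)
    qed
    show "H (\<lambda>x. f x + g x)" if fg: "H f \<and> H g" for f g
    proof -
      obtain P Q where "\<And>z. z \<in> sphere 0 r \<Longrightarrow> f z = Re (poly P z)"
        "\<And>z. z \<in> sphere 0 r \<Longrightarrow> g z = Re (poly Q z)" using fg unfolding H_def by blast
      then show ?thesis unfolding H_def by (intro exI[of _ "P + Q"]) simp
    qed
    show "H (\<lambda>x. f x * g x)" if fg: "H f \<and> H g" for f g
    proof -
      obtain P Q where PQ: "\<And>z. z \<in> sphere 0 r \<Longrightarrow> f z = Re (poly P z)"
        "\<And>z. z \<in> sphere 0 r \<Longrightarrow> g z = Re (poly Q z)" using fg unfolding H_def by blast
      obtain R where R: "\<And>z. z \<in> sphere 0 r \<Longrightarrow> Re (poly P z * cnj (poly Q z)) = Re (poly R z)"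
        using circle_Re_poly_mult_cnj by blast
      show ?thesis unfolding H_def
      proof (intro exI[of _ "smult (1/2) (P * Q) + smult (1/2) R"] ballI)
        fix z :: complex assume z: "z \<in> sphere 0 r"
        show "f z * g z = Re (poly (smult (1/2) (P * Q) + smult (1/2) R) z)"
          using R[OF z] by (simp add: PQ[OF z] field_simps)
      qed
    qed
    show "\<exists>f. H f \<and> f x \<noteq> f y" if "x \<in> sphere 0 r \<and> y \<in> sphere 0 r \<and> x \<noteq> y" for x y
    proof -
      have "H Re" unfolding H_def by (intro exI[of _ "[:0, 1:]"]) simp
      moreover have "H Im" unfolding H_def by (intro exI[of _ "[:0, -\<i>:]"]) simp
      ultimately show ?thesis using that complex_eqI by metis
    qed
  qed auto
  then show ?thesis unfolding H_def by fastforce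
qed

text \<open>Real parts of polynomials stand in for the Poisson integral of the boundary values: they
  have the mean value property exactly, and the minimum principle compares them with G at the
  centre.\<close>

lemma circle_mean_le_centre:
  assumes r: "0 \<le> r" and cont: "continuous_on (cball 0 r) G"
    and lap: "\<And>z. z \<in> ball 0 r \<Longrightarrow> laplacian_le G z 0"
  shows "integral {0..2*pi} (\<lambda>\<theta>. G (of_real r * cis \<theta>)) \<le> 2 * pi * G 0"
proof (rule field_le_epsilon)
  fix e :: real assume "e > 0"
  \<comment> \<open>The error e' occurs twice, at the centre and under the integral, and each is
    multiplied by 2 * pi.\<close>
  define e' where "e' = e / (4 * pi)"
  have e': "e' > 0" "4 * pi * e' = e" using \<open>e > 0\<close> by (auto simp: e'_def)
  have "continuous_on (sphere 0 r) G" by (rule continuous_on_subset[OF cont]) auto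
  then obtain P where P: "\<And>z. z \<in> sphere 0 r \<Longrightarrow> \<bar>G z - Re (poly P z)\<bar> < e'"
    using circle_approximation_Re_poly[OF _ e'(1)] by blast
  define H where "H = (\<lambda>z. G z + Re (poly ([:of_real e':] - P) z))"
  have "0 \<le> H 0"
  proof (rule laplacian_minimum_principle[OF r])
    show "continuous_on (cball 0 r) H" unfolding H_def by (intro continuous_intros cont)
    show "laplacian_le H z 0" if "z \<in> ball 0 r" for z
      using laplacian_le_add[OF lap[OF that] laplacian_le_Re_poly[of "[:of_real e':] - P" z]]
      unfolding H_def by simp
    show "0 \<le> H z" if "z \<in> sphere 0 r" for z
      using P[OF that] unfolding H_def by simp
  qed (use r in simp)
  then have centre: "Re (poly P 0) \<le> G 0 + e'" by (simp add: H_def)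
  have on: "of_real r * cis \<theta> \<in> sphere 0 r" for \<theta> using r by (simp add: norm_mult)
  have "continuous_on {0..2*pi} (\<lambda>\<theta>. G (of_real r * cis \<theta>))"
    by (rule continuous_on_compose2[OF cont]) (use r in \<open>auto intro!: continuous_intros simp: norm_mult\<close>)
  then have "integral {0..2*pi} (\<lambda>\<theta>. G (of_real r * cis \<theta>)) \<le> 2 * pi * Re (poly ([:of_real e':] + P) 0)"
  proof (intro has_integral_le[OF integrable_integral has_integral_circle_poly])
    show "G (of_real r * cis \<theta>) \<le> Re (poly ([:of_real e':] + P) (of_real r * cis \<theta>))" for \<theta>
      using P[OF on[of \<theta>]] by simp
  qed (rule integrable_continuous_real)
  also have "\<dots> \<le> 2 * pi * (G 0 + 2 * e')" using centre by simp
  also have "\<dots> = 2 * pi * G 0 + e" using e'(2) by (simp add: algebra_simps)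
  finally show "integral {0..2*pi} (\<lambda>\<theta>. G (of_real r * cis \<theta>)) \<le> 2 * pi * G 0 + e" .
qed

subsection \<open>Harmonic quasiregular maps\<close>

lemma has_vector_derivative_shift_0:
  assumes "((\<lambda>s. f (t + s)) has_vector_derivative d) (at (0::real))"
  shows "(f has_vector_derivative d) (at t)"
proof -
  have shift: "((\<lambda>s. s - t) has_vector_derivative 1) (at t)"
    by (auto intro!: derivative_eq_intros)
  have "((\<lambda>s. f (t + s)) has_vector_derivative d) (at (t - t))" using assms by simp
  then have "((\<lambda>s. f (t + s)) \<circ> (\<lambda>s. s - t) has_vector_derivative 1 *\<^sub>R d) (at t)"
    by (rule vector_diff_chain_at[OF shift])
  moreover have "(\<lambda>s. f (t + s)) \<circ> (\<lambda>s. s - t) = f" by (simp add: fun_eq_iff)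
  ultimately show ?thesis by simp
qed

lemma C1_on_has_vector_derivative:
  assumes "C1_on S f" "z + of_real t \<in> S"
  shows "((\<lambda>t. f (z + of_real t)) has_vector_derivative dx f (z + of_real t)) (at t)"
  unfolding dx_def
  by (rule has_vector_derivative_shift_0) (use assms in \<open>auto simp: C1_on_def vector_derivative_works add.assoc\<close>)

lemma C1_on_has_vector_derivative_i:
  assumes "C1_on S f" "z + \<i> * of_real t \<in> S"
  shows "((\<lambda>t. f (z + \<i> * of_real t)) has_vector_derivative dy f (z + \<i> * of_real t)) (at t)"
  unfolding dy_def
  by (rule has_vector_derivative_shift_0) (use assms in \<open>auto simp: C1_on_def vector_derivative_works add.assoc distrib_left\<close>)

lemma tendsto_line: "((\<lambda>t. z + c * of_real t) \<longlongrightarrow> (z::complex)) (nhds 0)"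
proof -
  have "isCont (\<lambda>t. z + c * of_real t) 0" by (intro continuous_intros)
  then show ?thesis
    using tendsto_at_iff_tendsto_nhds[of "\<lambda>t. z + c * of_real t" 0] by (simp add: isCont_def)
qed

lemma eventually_line:
  assumes "open S" "z \<in> S"
  shows "\<forall>\<^sub>F t in nhds 0. z + c * of_real t \<in> (S :: complex set)"
  using tendsto_line[of z c] assms by (auto simp: tendsto_def)

lemma harmonic_on_jet2:
  assumes "harmonic_on S f" "open S" "z \<in> S"
  shows "jet2 (\<lambda>t. f (z + of_real t)) (dx f z) (dx (dx f) z)"
    and "jet2 (\<lambda>t. f (z + \<i> * of_real t)) (dy f z) (dy (dy f) z)"
proof -
  have C: "C1_on S f" "C1_on S (dx f)" "C1_on S (dy f)" using assms by (auto simp: harmonic_on_def)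
  show "jet2 (\<lambda>t. f (z + of_real t)) (dx f z) (dx (dx f) z)" unfolding jet2_def
  proof (intro exI[of _ "\<lambda>t. dx f (z + of_real t)"] conjI)
    show "\<forall>\<^sub>F t in nhds 0. ((\<lambda>t. f (z + of_real t)) has_vector_derivative dx f (z + of_real t)) (at t)"
      using eventually_line[OF assms(2,3), of 1]
      by eventually_elim (auto intro!: C1_on_has_vector_derivative[OF C(1)])
    show "((\<lambda>t. dx f (z + of_real t)) has_vector_derivative dx (dx f) z) (at 0)"
      using C1_on_has_vector_derivative[OF C(2), of z 0] assms by simp
  qed simp
  show "jet2 (\<lambda>t. f (z + \<i> * of_real t)) (dy f z) (dy (dy f) z)" unfolding jet2_def
  proof (intro exI[of _ "\<lambda>t. dy f (z + \<i> * of_real t)"] conjI)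
    show "\<forall>\<^sub>F t in nhds 0. ((\<lambda>t. f (z + \<i> * of_real t)) has_vector_derivative dy f (z + \<i> * of_real t)) (at t)"
      using eventually_line[OF assms(2,3), of \<i>]
      by eventually_elim (auto intro!: C1_on_has_vector_derivative_i[OF C(1)])
    show "((\<lambda>t. dy f (z + \<i> * of_real t)) has_vector_derivative dy (dy f) z) (at 0)"
      using C1_on_has_vector_derivative_i[OF C(3), of z 0] assms by simp
  qed simp
qed

lemma norm_increment_le:
  fixes g :: "real \<Rightarrow> 'a::real_normed_vector"
  assumes "\<And>t. t \<in> closed_segment 0 b \<Longrightarrow> (g has_vector_derivative g' t) (at t)"
    "\<And>t. t \<in> closed_segment 0 b \<Longrightarrow> norm (g' t) \<le> B"
  shows "norm (g b - g 0) \<le> B * \<bar>b\<bar>"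
proof -
  have "norm (g b - g 0) \<le> B * norm (b - 0)"
  proof (rule differentiable_bound[of "closed_segment 0 b" g "\<lambda>t h. h *\<^sub>R g' t"])
    fix t assume t: "t \<in> closed_segment 0 b"
    show "(g has_derivative (\<lambda>h. h *\<^sub>R g' t)) (at t within closed_segment 0 b)"
      using assms(1)[OF t] by (simp add: has_vector_derivative_def has_derivative_at_withinI)
    show "onorm (\<lambda>h. h *\<^sub>R g' t) \<le> B"
      using assms(2)[OF t] by (intro onorm_le) (simp add: mult.commute[of B] mult_left_mono)
  qed auto
  then show ?thesis by simp
qed

text \<open>\<open>C1_on\<close> speaks of the partial derivatives only. On a closed disc they are
  bounded, and z + h is reached from z by a horizontal and a vertical step that stay in the disc, so
  f is Lipschitz at z.\<close>

lemma C1_on_imp_continuous_on: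
  assumes C: "C1_on S f" and S: "open S"
  shows "continuous_on S f"
proof (rule continuous_at_imp_continuous_on, rule ballI)
  fix z assume "z \<in> S"
  then obtain e where e: "e > 0" "cball z e \<subseteq> S" using S open_contains_cball by blast
  have "bounded (dx f ` cball z e)" "bounded (dy f ` cball z e)"
    using C e(2) by (auto simp: C1_on_def intro!: compact_imp_bounded compact_continuous_image
        intro: continuous_on_subset)
  then obtain B1 B2 where B12: "\<And>x. x \<in> cball z e \<Longrightarrow> norm (dx f x) \<le> B1"
      "\<And>x. x \<in> cball z e \<Longrightarrow> norm (dy f x) \<le> B2"
    unfolding bounded_iff by blast
  define B where "B = max B1 B2"
  have B: "norm (dx f x) \<le> B \<and> norm (dy f x) \<le> B" if "x \<in> cball z e" for x
    using B12[OF that] by (auto simp: B_def)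
  have bd: "norm (f (z + h) - f z) \<le> B * (\<bar>Re h\<bar> + \<bar>Im h\<bar>)" if h: "norm h \<le> e" for h
  proof -
    have seg: "\<bar>t\<bar> \<le> \<bar>b\<bar>" if "t \<in> closed_segment 0 b" for t b :: real
      using that by (auto simp: closed_segment_eq_real_ivl split: if_splits)
    have le: "cmod (Complex x y) \<le> e" if "\<bar>x\<bar> \<le> \<bar>Re h\<bar>" "\<bar>y\<bar> \<le> \<bar>Im h\<bar>" for x y
    proof -
      have "cmod (Complex x y) \<le> cmod h"
        unfolding cmod_def using that by (intro real_sqrt_le_mono add_mono) (auto simp: abs_le_square_iff)
      then show ?thesis using h by simp
    qed
    have in1: "z + of_real t \<in> cball z e" if "t \<in> closed_segment 0 (Re h)" for t
      using le[of t 0] seg[OF that] by (simp add: dist_norm complex_of_real_def)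
    have in2: "z + of_real (Re h) + \<i> * of_real t \<in> cball z e" if "t \<in> closed_segment 0 (Im h)" for t
    proof -
      have "of_real (Re h) + \<i> * of_real t = Complex (Re h) t" by (simp add: complex_eq_iff)
      then show ?thesis
        using le[of "Re h" t] seg[OF that] by (simp add: dist_norm add.assoc)
    qed
    have "norm (f (z + of_real (Re h)) - f (z + of_real 0)) \<le> B * \<bar>Re h\<bar>"
      by (rule norm_increment_le[where g = "\<lambda>t. f (z + of_real t)" and g' = "\<lambda>t. dx f (z + of_real t)"])
        (use in1 e(2) B in \<open>auto intro!: C1_on_has_vector_derivative[OF C]\<close>)
    moreover have "norm (f (z + of_real (Re h) + \<i> * of_real (Im h)) - f (z + of_real (Re h) + \<i> * of_real 0))
        \<le> B * \<bar>Im h\<bar>"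
      by (rule norm_increment_le[where g = "\<lambda>t. f (z + of_real (Re h) + \<i> * of_real t)"
            and g' = "\<lambda>t. dy f (z + of_real (Re h) + \<i> * of_real t)"])
        (use in2 e(2) B in \<open>auto intro!: C1_on_has_vector_derivative_i[OF C]\<close>)
    moreover have "z + of_real (Re h) + \<i> * of_real (Im h) = z + h"
      by (simp add: complex_eq_iff)
    ultimately show ?thesis
      using norm_triangle_ineq[of "f (z + h) - f (z + of_real (Re h))" "f (z + of_real (Re h)) - f z"]
      by (simp add: algebra_simps)
  qed
  have "((\<lambda>h. f (z + h) - f z) \<longlongrightarrow> 0) (at 0)"
  proof (rule tendsto_0_le)
    show "((\<lambda>h. B * (\<bar>Re h\<bar> + \<bar>Im h\<bar>)) \<longlongrightarrow> 0) (at 0)"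
      by (auto intro!: tendsto_eq_intros)
    show "\<forall>\<^sub>F h in at 0. norm (f (z + h) - f z) \<le> norm (B * (\<bar>Re h\<bar> + \<bar>Im h\<bar>)) * 1"
      unfolding eventually_at using e(1)
      by (intro exI[of _ e]) (auto simp: dist_norm intro!: order_trans[OF bd abs_ge_self])
  qed
  then show "isCont f z"
    by (simp add: isCont_iff Lim_null[symmetric])
qed

text \<open>The set where h is negative is open and null, hence empty. This makes the dilatation
  condition pointwise, since the derivatives of a harmonic map are continuous.\<close>

lemma AE_nonneg_imp_nonneg:
  fixes h :: "complex \<Rightarrow> real"
  assumes "continuous_on S h" "open S" "AE z in lebesgue. z \<in> S \<longrightarrow> 0 \<le> h z" "z \<in> S"
  shows "0 \<le> h z"
proof (rule ccontr)
  assume neg: "\<not> 0 \<le> h z"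
  define U where "U = S \<inter> h -` {..<0}"
  have "open U" unfolding U_def
    using assms(1,2) by (metis Int_commute continuous_on_open_vimage open_lessThan)
  moreover have "z \<in> U" using assms(4) neg by (simp add: U_def)
  moreover obtain N where "N \<in> null_sets lebesgue" "{z \<in> space lebesgue. \<not> (z \<in> S \<longrightarrow> 0 \<le> h z)} \<subseteq> N"
    using assms(3) by (auto simp: eventually_ae_filter)
  then have "negligible U"
    by (intro negligible_subset[of N U]) (auto simp: negligible_iff_null_sets U_def)
  ultimately show False using open_not_negligible by blast
qed

text \<open>With a = \<bar>f_z\<bar> and b = \<bar>f_zbar\<bar> the dilatation condition becomes a +
  b \<le> K * (a - b). The gradients of Re f and Im f have lengths \<bar>P + cnj Q\<bar> and \<bar>P
  - cnj Q\<bar>, both between a - b and a + b. In the second bound the sum of squares is 4 * P * Q,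
  of modulus 4 * a * b = (a + b)^2 - (a - b)^2.\<close>

lemma quasiregular_gradient_bounds:
  assumes K: "K \<ge> 1" and f: "harmonic_quasiregular K f" and z: "z \<in> ball 0 1"
  shows "(Im (dx f z))\<^sup>2 + (Im (dy f z))\<^sup>2 \<le> K\<^sup>2 * ((Re (dx f z))\<^sup>2 + (Re (dy f z))\<^sup>2)"
    and "cmod ((dx f z)\<^sup>2 + (dy f z)\<^sup>2) \<le> (K\<^sup>2 - 1) * ((Re (dx f z))\<^sup>2 + (Re (dy f z))\<^sup>2)"
proof -
  have c: "continuous_on (ball 0 1) (dx f)" "continuous_on (ball 0 1) (dy f)"
    using f by (auto simp: harmonic_quasiregular_def harmonic_on_def C1_on_def)
  have "0 \<le> K * Jac f z - (Lambda f z)\<^sup>2"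
  proof (rule AE_nonneg_imp_nonneg[where S = "ball 0 1"])
    show "continuous_on (ball 0 1) (\<lambda>z. K * Jac f z - (Lambda f z)\<^sup>2)"
      unfolding Jac_def Lambda_def dz_def dzbar_def by (intro continuous_intros c) auto
    show "AE z in lebesgue. z \<in> ball 0 1 \<longrightarrow> 0 \<le> K * Jac f z - (Lambda f z)\<^sup>2"
      using f by (auto simp: harmonic_quasiregular_def quasiregular_def)
  qed (use z in auto)
  define P Q where "P = dz f z" and "Q = dzbar f z"
  define a b where "a = cmod P" and "b = cmod Q"
  have X: "dx f z = P + Q" and Y: "dy f z = \<i> * (P - Q)"
    by (auto simp: P_def Q_def dz_def dzbar_def field_simps)
  have ab: "(a + b)\<^sup>2 \<le> K * (a\<^sup>2 - b\<^sup>2)" "a \<ge> 0" "b \<ge> 0"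
    using \<open>0 \<le> K * Jac f z - (Lambda f z)\<^sup>2\<close> by (auto simp: Jac_def Lambda_def a_def b_def P_def Q_def)
  then have "(a + b) * (a + b) \<le> (a + b) * (K * (a - b))"
    by (simp add: power2_eq_square algebra_simps)
  then have lin: "a + b \<le> K * (a - b)"
  proof (cases "a + b = 0")
    case True
    then have "a = 0" "b = 0" using ab(2,3) by auto
    then show ?thesis by simp
  next
    case False
    then have "0 < a + b" using ab(2,3) by simp
    then show ?thesis using \<open>(a + b) * (a + b) \<le> (a + b) * (K * (a - b))\<close> by (rule mult_left_le_imp_le[rotated])
  qed
  have gu: "(Re (dx f z))\<^sup>2 + (Re (dy f z))\<^sup>2 = (cmod (P + cnj Q))\<^sup>2"
    unfolding X Y cmod_power2 by (simp add: power2_eq_square algebra_simps)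
  have gv: "(Im (dx f z))\<^sup>2 + (Im (dy f z))\<^sup>2 = (cmod (P - cnj Q))\<^sup>2"
    unfolding X Y cmod_power2 by (simp add: power2_eq_square algebra_simps)
  have "a \<ge> b"
  proof (rule ccontr)
    assume "\<not> b \<le> a"
    then have "K * (a - b) < 0" using K by (simp add: mult_pos_neg)
    then show False using lin ab(2,3) by simp
  qed
  have l: "(a - b)\<^sup>2 \<le> (cmod (P + cnj Q))\<^sup>2"
    using norm_diff_ineq[of P "cnj Q"] \<open>a \<ge> b\<close> by (intro power_mono) (auto simp: a_def b_def)
  have u: "(cmod (P - cnj Q))\<^sup>2 \<le> (a + b)\<^sup>2"
    using norm_triangle_ineq4[of P "cnj Q"] by (intro power_mono) (auto simp: a_def b_def)
  have sq: "(a + b)\<^sup>2 \<le> K\<^sup>2 * (a - b)\<^sup>2"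
    using power_mono[OF lin, of 2] ab(2,3) by (simp add: power_mult_distrib)
  also have "\<dots> \<le> K\<^sup>2 * (cmod (P + cnj Q))\<^sup>2" using l by (intro mult_left_mono) auto
  finally show "(Im (dx f z))\<^sup>2 + (Im (dy f z))\<^sup>2 \<le> K\<^sup>2 * ((Re (dx f z))\<^sup>2 + (Re (dy f z))\<^sup>2)"
    using u gu gv by simp
  have "(dx f z)\<^sup>2 + (dy f z)\<^sup>2 = 4 * (P * Q)"
    unfolding X Y by (simp add: power2_eq_square algebra_simps)
  then have "cmod ((dx f z)\<^sup>2 + (dy f z)\<^sup>2) = (a + b)\<^sup>2 - (a - b)\<^sup>2"
    by (simp add: a_def b_def norm_mult power2_eq_square algebra_simps)
  also have "\<dots> \<le> (K\<^sup>2 - 1) * (a - b)\<^sup>2" using sq by (simp add: algebra_simps)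
  also have "\<dots> \<le> (K\<^sup>2 - 1) * (cmod (P + cnj Q))\<^sup>2"
    using l K by (intro mult_left_mono) (auto simp: one_le_power)
  finally show "cmod ((dx f z)\<^sup>2 + (dy f z)\<^sup>2) \<le> (K\<^sup>2 - 1) * ((Re (dx f z))\<^sup>2 + (Re (dy f z))\<^sup>2)"
    using gu by simp
qed

subsection \<open>Second derivatives along harmonic maps\<close>

lemma jet2_add: "jet2 \<phi> a b \<Longrightarrow> jet2 \<psi> c d \<Longrightarrow> jet2 (\<lambda>t. \<phi> t + \<psi> t) (a + c) (b + d)"
  unfolding jet2_def
proof (elim exE conjE)
  fix \<phi>' \<psi>'
  assume ev: "\<forall>\<^sub>F t in nhds 0. (\<phi> has_vector_derivative \<phi>' t) (at t)"
    "\<forall>\<^sub>F t in nhds 0. (\<psi> has_vector_derivative \<psi>' t) (at t)"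
    and r: "\<phi>' 0 = a" "\<psi>' 0 = c" "(\<phi>' has_vector_derivative b) (at 0)" "(\<psi>' has_vector_derivative d) (at 0)"
  show "\<exists>\<phi>'. (\<forall>\<^sub>F t in nhds 0. ((\<lambda>t. \<phi> t + \<psi> t) has_vector_derivative \<phi>' t) (at t)) \<and>
         \<phi>' 0 = a + c \<and> (\<phi>' has_vector_derivative b + d) (at 0)"
  proof (intro exI[of _ "\<lambda>t. \<phi>' t + \<psi>' t"] conjI)
    show "\<forall>\<^sub>F t in nhds 0. ((\<lambda>t. \<phi> t + \<psi> t) has_vector_derivative \<phi>' t + \<psi>' t) (at t)"
      using ev by eventually_elim (rule has_vector_derivative_add)
  qed (use r in \<open>auto intro: has_vector_derivative_add\<close>)
qed

lemma jet2_bounded_linear: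
  assumes "bounded_linear h" "jet2 \<phi> a b"
  shows "jet2 (\<lambda>t. h (\<phi> t)) (h a) (h b)"
proof -
  obtain \<phi>' where ev: "\<forall>\<^sub>F t in nhds 0. (\<phi> has_vector_derivative \<phi>' t) (at t)"
    and r: "\<phi>' 0 = a" "(\<phi>' has_vector_derivative b) (at 0)"
    using assms(2) by (auto simp: jet2_def)
  show ?thesis unfolding jet2_def
  proof (intro exI[of _ "\<lambda>t. h (\<phi>' t)"] conjI)
    show "\<forall>\<^sub>F t in nhds 0. ((\<lambda>t. h (\<phi> t)) has_vector_derivative h (\<phi>' t)) (at t)"
      using ev by eventually_elim (rule bounded_linear.has_vector_derivative[OF assms(1)])
  qed (use r in \<open>auto intro: bounded_linear.has_vector_derivative[OF assms(1)]\<close>)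
qed

text \<open>The second-order chain rule, over a normed field so that it serves real powers and the
  complex \<open>powr\<close> alike.\<close>

lemma jet2_compose:
  fixes \<phi> :: "real \<Rightarrow> 'a::real_normed_field"
  assumes "jet2 \<phi> a b"
    and H: "\<forall>\<^sub>F w in nhds (\<phi> 0). (H has_field_derivative H' w) (at w)"
    and H': "(H' has_field_derivative h) (at (\<phi> 0))"
  shows "jet2 (\<lambda>t. H (\<phi> t)) (H' (\<phi> 0) * a) (h * a\<^sup>2 + H' (\<phi> 0) * b)"
proof -
  obtain \<phi>' where ev: "\<forall>\<^sub>F t in nhds 0. (\<phi> has_vector_derivative \<phi>' t) (at t)"
    and r: "\<phi>' 0 = a" "(\<phi>' has_vector_derivative b) (at 0)"
    using assms(1) by (auto simp: jet2_def)
  have d0: "(\<phi> has_vector_derivative a) (at 0)"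
    using eventually_nhds_x_imp_x[OF ev] r by simp
  then have "isCont \<phi> 0" by (rule has_vector_derivative_continuous)
  then have "(\<phi> \<longlongrightarrow> \<phi> 0) (nhds 0)" unfolding isCont_def tendsto_at_iff_tendsto_nhds .
  then have evH: "\<forall>\<^sub>F t in nhds 0. (H has_field_derivative H' (\<phi> t)) (at (\<phi> t))"
    using H by (rule eventually_compose_filterlim[rotated])
  show ?thesis unfolding jet2_def
  proof (intro exI[of _ "\<lambda>t. H' (\<phi> t) * \<phi>' t"] conjI)
    show "\<forall>\<^sub>F t in nhds 0. ((\<lambda>t. H (\<phi> t)) has_vector_derivative H' (\<phi> t) * \<phi>' t) (at t)"
      using ev evH
    proof eventually_elim
      case (elim t)
      from field_vector_diff_chain_at[OF elim] show ?case by (simp add: o_def mult.commute)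
    qed
    have "((\<lambda>t. H' (\<phi> t)) has_vector_derivative a * h) (at 0)"
      using field_vector_diff_chain_at[OF d0 H'] by (simp add: o_def)
    from has_vector_derivative_mult[OF this r(2)]
    show "((\<lambda>t. H' (\<phi> t) * \<phi>' t) has_vector_derivative h * a\<^sup>2 + H' (\<phi> 0) * b) (at 0)"
      by (simp add: r power2_eq_square algebra_simps)
  qed (simp add: r)
qed

section \<open>Derivatives of absolute powers, the origin included\<close>

lemma has_real_derivative_abs_powr:
  assumes "q > 1"
  shows "((\<lambda>x. \<bar>x\<bar> powr q) has_real_derivative q * (\<bar>x\<bar> powr (q - 1) * sgn x)) (at x)"
proof -
  consider "x > 0" | "x < 0" | "x = 0" by linarith
  then show ?thesis
  proof cases
    case 1
    have "((\<lambda>x. x powr q) has_real_derivative q * (\<bar>x\<bar> powr (q - 1) * sgn x)) (at x)"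
      using 1 by (auto intro!: derivative_eq_intros)
    then show ?thesis
      by (rule has_field_derivative_transform_within_open[of _ _ _ "{0<..}"]) (use 1 in auto)
  next
    case 2
    have "((\<lambda>x. (- x) powr q) has_real_derivative q * (\<bar>x\<bar> powr (q - 1) * sgn x)) (at x)"
      using 2 by (auto intro!: derivative_eq_intros)
    then show ?thesis
      by (rule has_field_derivative_transform_within_open[of _ _ _ "{..<0}"]) (use 2 in auto)
  next
    case 3
    have "((\<lambda>h. \<bar>h\<bar> powr (q - 1)) \<longlongrightarrow> 0) (at (0::real))"
      using assms by (intro tendsto_eq_intros tendsto_zero_powrI) (auto intro!: tendsto_eq_intros)
    moreover have "\<forall>\<^sub>F h in at (0::real). norm ((\<bar>0 + h\<bar> powr q - \<bar>0\<bar> powr q) / h) \<le> norm (\<bar>h\<bar> powr (q - 1)) * 1"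
      using assms by (auto simp: eventually_at_filter powr_diff intro!: always_eventually)
    ultimately have "((\<lambda>h. (\<bar>0 + h\<bar> powr q - \<bar>0\<bar> powr q) / h) \<longlongrightarrow> 0) (at (0::real))"
      by (rule tendsto_0_le)
    then show ?thesis using 3 by (simp add: DERIV_def)
  qed
qed

text \<open>Together with \<open>has_real_derivative_abs_powr\<close> this differentiates
  \<bar>x\<bar> powr p twice, also at 0. It is then applied with exponent p - 1, so q > 1 means p >
  2; the exponent 2 is treated separately.\<close>

lemma has_real_derivative_abs_powr_sgn:
  assumes "q > 1"
  shows "((\<lambda>x. \<bar>x\<bar> powr q * sgn x) has_real_derivative q * \<bar>x\<bar> powr (q - 1)) (at x)"
proof -
  consider "x > 0" | "x < 0" | "x = 0" by linarith
  then show ?thesis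
  proof cases
    case 1
    have "((\<lambda>x. x powr q) has_real_derivative q * \<bar>x\<bar> powr (q - 1)) (at x)"
      using 1 by (auto intro!: derivative_eq_intros)
    then show ?thesis
      by (rule has_field_derivative_transform_within_open[of _ _ _ "{0<..}"]) (use 1 in auto)
  next
    case 2
    have "((\<lambda>x. - ((- x) powr q)) has_real_derivative q * \<bar>x\<bar> powr (q - 1)) (at x)"
      using 2 by (auto intro!: derivative_eq_intros)
    then show ?thesis
      by (rule has_field_derivative_transform_within_open[of _ _ _ "{..<0}"]) (use 2 in auto)
  next
    case 3
    have "((\<lambda>h. \<bar>h\<bar> powr (q - 1)) \<longlongrightarrow> 0) (at (0::real))"
      using assms by (intro tendsto_eq_intros tendsto_zero_powrI) (auto intro!: tendsto_eq_intros)
    moreover have "\<forall>\<^sub>F h in at (0::real). norm ((\<bar>0 + h\<bar> powr q * sgn (0 + h) - \<bar>0\<bar> powr q * sgn 0) / h) \<le> norm (\<bar>h\<bar> powr (q - 1)) * 1"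
      using assms by (auto simp: eventually_at_filter powr_diff abs_mult abs_sgn_eq intro!: always_eventually)
    ultimately have "((\<lambda>h. (\<bar>0 + h\<bar> powr q * sgn (0 + h) - \<bar>0\<bar> powr q * sgn 0) / h) \<longlongrightarrow> 0) (at (0::real))"
      by (rule tendsto_0_le)
    then show ?thesis using 3 by (simp add: DERIV_def)
  qed
qed

text \<open>\<open>q\<close> is the Hessian form of \<open>T\<close> at \<open>w\<close>, described through restrictions of \<open>T\<close> to curves; the
  first-order term \<open>l\<close> cancels in the Laplacian of a composition with a harmonic map.\<close>

definition hessian_at :: "(complex \<Rightarrow> real) \<Rightarrow> complex \<Rightarrow> (complex \<Rightarrow> real) \<Rightarrow> bool" where
  "hessian_at T w q \<longleftrightarrow> (\<exists>l. linear l \<and>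
     (\<forall>\<psi> a b. \<psi> 0 = w \<longrightarrow> jet2 \<psi> a b \<longrightarrow> (\<exists>d. jet2 (\<lambda>t. T (\<psi> t)) d (q a + l b))))"

lemma hessian_atI:
  assumes "linear l" "\<And>\<psi> a b. \<psi> 0 = w \<Longrightarrow> jet2 \<psi> a b \<Longrightarrow> jet2 (\<lambda>t. T (\<psi> t)) (d a) (q a + l b)"
  shows "hessian_at T w q"
  using assms unfolding hessian_at_def by blast

lemma hessian_at_laplacian_le:
  assumes f: "harmonic_on S f" "open S" "z \<in> S" and T: "hessian_at T (f z) q"
  shows "laplacian_le (\<lambda>x. T (f x)) z (q (dx f z) + q (dy f z))"
proof -
  obtain l where l: "linear l" and
    j: "\<And>\<psi> a b. \<psi> 0 = f z \<Longrightarrow> jet2 \<psi> a b \<Longrightarrow> \<exists>d. jet2 (\<lambda>t. T (\<psi> t)) d (q a + l b)"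
    using T unfolding hessian_at_def by blast
  obtain d1 d2 where d: "jet2 (\<lambda>t. T (f (z + of_real t))) d1 (q (dx f z) + l (dx (dx f) z))"
    "jet2 (\<lambda>t. T (f (z + \<i> * of_real t))) d2 (q (dy f z) + l (dy (dy f) z))"
    using j[OF _ harmonic_on_jet2(1)[OF f]] j[OF _ harmonic_on_jet2(2)[OF f]] by auto
  have "l (dx (dx f) z) + l (dy (dy f) z) = l (dx (dx f) z + dy (dy f) z)"
    by (simp add: linear_add[OF l])
  also have "\<dots> = 0" using f linear_0[OF l] by (simp add: harmonic_on_def)
  finally have eq: "q (dx f z) + l (dx (dx f) z) + (q (dy f z) + l (dy (dy f) z)) = q (dx f z) + q (dy f z)"
    by simp
  show ?thesis using laplacian_le_jet2[OF d] unfolding eq .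
qed

lemma hessian_at_add:
  assumes "hessian_at S w q" "hessian_at T w r"
  shows "hessian_at (\<lambda>x. S x + T x) w (\<lambda>a. q a + r a)"
proof -
  obtain l where l: "linear l" and
    jl: "\<And>\<psi> a b. \<psi> 0 = w \<Longrightarrow> jet2 \<psi> a b \<Longrightarrow> \<exists>d. jet2 (\<lambda>t. S (\<psi> t)) d (q a + l b)"
    using assms(1) unfolding hessian_at_def by blast
  obtain m where m: "linear m" and
    jm: "\<And>\<psi> a b. \<psi> 0 = w \<Longrightarrow> jet2 \<psi> a b \<Longrightarrow> \<exists>d. jet2 (\<lambda>t. T (\<psi> t)) d (r a + m b)"
    using assms(2) unfolding hessian_at_def by blast
  show ?thesis unfolding hessian_at_def
  proof (intro exI[of _ "\<lambda>x. l x + m x"] conjI allI impI)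
    show "linear (\<lambda>x. l x + m x)" using l m by (rule linear_compose_add)
    fix \<psi> a b assume "\<psi> 0 = w" "jet2 \<psi> a b"
    then obtain d1 d2 where "jet2 (\<lambda>t. S (\<psi> t)) d1 (q a + l b)" "jet2 (\<lambda>t. T (\<psi> t)) d2 (r a + m b)"
      using jl jm by blast
    from jet2_add[OF this] show "\<exists>d. jet2 (\<lambda>t. S (\<psi> t) + T (\<psi> t)) d (q a + r a + (l b + m b))"
      by (intro exI[of _ "d1 + d2"]) (simp add: algebra_simps)
  qed
qed

lemma hessian_at_cmult:
  assumes "hessian_at T w q"
  shows "hessian_at (\<lambda>x. c * T x) w (\<lambda>a. c * q a)"
proof -
  obtain l where l: "linear l" and
    jl: "\<And>\<psi> a b. \<psi> 0 = w \<Longrightarrow> jet2 \<psi> a b \<Longrightarrow> \<exists>d. jet2 (\<lambda>t. T (\<psi> t)) d (q a + l b)"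
    using assms(1) unfolding hessian_at_def by blast
  show ?thesis unfolding hessian_at_def
  proof (intro exI[of _ "\<lambda>x. c * l x"] conjI allI impI)
    show "linear (\<lambda>x. c * l x)" using linear_compose_scale_right[OF l, of c] by simp
    fix \<psi> a b assume "\<psi> 0 = w" "jet2 \<psi> a b"
    then obtain d where "jet2 (\<lambda>t. T (\<psi> t)) d (q a + l b)" using jl by blast
    from jet2_bounded_linear[OF bounded_linear_mult_right this, of c]
    show "\<exists>d. jet2 (\<lambda>t. c * T (\<psi> t)) d (c * q a + c * l b)" by (auto simp: distrib_left)
  qed
qed

lemma hessian_at_compose_linear:
  fixes h :: "complex \<Rightarrow> real"
  assumes h: "bounded_linear h"
    and H: "\<forall>\<^sub>F x in nhds (h w). (H has_field_derivative H' x) (at x)"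
    and H': "(H' has_field_derivative k) (at (h w))"
  shows "hessian_at (\<lambda>w. H (h w)) w (\<lambda>a. k * (h a)\<^sup>2)"
proof (rule hessian_atI[where l = "\<lambda>b. H' (h w) * h b"])
  show "linear (\<lambda>b. H' (h w) * h b)"
    using linear_compose_scale_right[OF bounded_linear.linear[OF h], of "H' (h w)"] by simp
  show "jet2 (\<lambda>t. H (h (\<psi> t))) (H' (h w) * h a) (k * (h a)\<^sup>2 + H' (h w) * h b)"
    if \<psi>: "\<psi> 0 = w" "jet2 \<psi> a b" for \<psi> a b
    using jet2_compose[OF jet2_bounded_linear[OF h \<psi>(2)], of H H' k] H H' \<psi>(1) by simp
qed

lemma hessian_at_abs_powr:
  assumes "bounded_linear h" "p > 2"
  shows "hessian_at (\<lambda>w. \<bar>h w\<bar> powr p) w (\<lambda>a. p * (p - 1) * \<bar>h w\<bar> powr (p - 2) * (h a)\<^sup>2)"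
proof (rule hessian_at_compose_linear[OF assms(1)])
  show "\<forall>\<^sub>F x in nhds (h w). ((\<lambda>x. \<bar>x\<bar> powr p) has_real_derivative p * (\<bar>x\<bar> powr (p - 1) * sgn x)) (at x)"
    using assms(2) by (intro always_eventually allI has_real_derivative_abs_powr) simp
  show "((\<lambda>x. p * (\<bar>x\<bar> powr (p - 1) * sgn x)) has_real_derivative p * (p - 1) * \<bar>h w\<bar> powr (p - 2)) (at (h w))"
    using DERIV_cmult[OF has_real_derivative_abs_powr_sgn[of "p - 1" "h w"], of p] assms(2) by (simp add: mult.assoc)
qed

lemma hessian_at_square:
  assumes "bounded_linear h"
  shows "hessian_at (\<lambda>w. (h w)\<^sup>2) w (\<lambda>a. 2 * (h a)\<^sup>2)"
  by (rule hessian_at_compose_linear[OF assms, where H' = "\<lambda>x. 2 * x"])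
    (auto intro!: derivative_eq_intros always_eventually)

text \<open>The form is complex quadratic in \<open>a\<close>: its sum over a = f_x and a = f_y only
  involves (f_x)^2 + (f_y)^2, the quantity estimated in \<open>quasiregular_gradient_bounds\<close>.
  Positivity of Re (c * w) keeps the power off its branch cut.\<close>

lemma hessian_at_Re_powr:
  assumes "0 < Re (c * w)"
  shows "hessian_at (\<lambda>w. Re ((c * w) powr of_real p)) w
           (\<lambda>a. Re (of_real (p * (p - 1)) * (c * w) powr of_real (p - 2) * (c * a)\<^sup>2))"
proof (rule hessian_atI[where l = "\<lambda>b. Re (of_real p * (c * w) powr of_real (p - 1) * (c * b))"])
  show "linear (\<lambda>b. Re (of_real p * (c * w) powr of_real (p - 1) * (c * b)))"
    by (intro bounded_linear.linear bounded_linear_compose[OF bounded_linear_Re]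
        bounded_linear_compose[OF bounded_linear_mult_right] bounded_linear_mult_right)
  fix \<psi> a b assume \<psi>: "\<psi> 0 = w" "jet2 \<psi> a b"
  have n: "x \<notin> \<real>\<^sub>\<le>\<^sub>0" if "Re x > 0" for x using that by (auto simp: complex_nonpos_Reals_iff)
  have op: "open {x. 0 < Re x}" by (simp add: open_halfspace_Re_gt)
  have "jet2 (\<lambda>t. (c * \<psi> t) powr of_real p) (of_real p * (c * w) powr of_real (p - 1) * (c * a))
    (of_real (p * (p - 1)) * (c * w) powr of_real (p - 2) * (c * a)\<^sup>2 +
       of_real p * (c * w) powr of_real (p - 1) * (c * b))"
    using \<psi>(1) assms
    apply (subst \<psi>(1)[symmetric])+
    apply (rule jet2_compose[OF jet2_bounded_linear[OF bounded_linear_mult_right \<psi>(2)],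
        where H = "\<lambda>x. x powr of_real p" and H' = "\<lambda>x. of_real p * x powr of_real (p - 1)"])
     apply (rule eventually_mono[OF eventually_nhds_in_open[OF op]])
      apply (auto intro!: derivative_eq_intros n simp: diff_diff_eq)
    done
  from jet2_bounded_linear[OF bounded_linear_Re this]
  show "jet2 (\<lambda>t. Re ((c * \<psi> t) powr of_real p)) (Re (of_real p * (c * w) powr of_real (p - 1) * (c * a)))
    (Re (of_real (p * (p - 1)) * (c * w) powr of_real (p - 2) * (c * a)\<^sup>2) +
       Re (of_real p * (c * w) powr of_real (p - 1) * (c * b)))"
    by simp
qed

text \<open>The lower bound drops the rank-one part of the Hessian, which is nonnegative for \<open>p \<ge> 2\<close>.\<close>

lemma hessian_at_quadratic_powr:
  assumes p: "p \<ge> 2" and L: "L > 0" and w: "w \<noteq> 0"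
  defines "N \<equiv> \<lambda>w. (Im w)\<^sup>2 + L * (Re w)\<^sup>2"
  shows "\<exists>q. hessian_at (\<lambda>w. N w powr (p / 2)) w q \<and> (\<forall>a. p * N w powr (p / 2 - 1) * N a \<le> q a)"
proof -
  have N: "N w > 0" using w L unfolding N_def
    by (cases "Re w = 0") (auto simp: complex_eq_iff add_nonneg_pos add_pos_nonneg)
  \<comment> \<open>\<open>n a\<close> is the derivative of N at w in direction \<open>a\<close>,
    and \<open>2 * N a\<close> its second derivative.\<close>
  define n where "n a = 2 * (Im w * Im a + L * (Re w * Re a))" for a
  define q where "q a = p / 2 * (p / 2 - 1) * N w powr (p / 2 - 2) * (n a)\<^sup>2 + p / 2 * N w powr (p / 2 - 1) * (2 * N a)" for a
  have "hessian_at (\<lambda>w. N w powr (p / 2)) w q"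
  proof (rule hessian_atI[where l = "\<lambda>b. p / 2 * N w powr (p / 2 - 1) * n b"])
    show "linear (\<lambda>b. p / 2 * N w powr (p / 2 - 1) * n b)"
      unfolding n_def
      by (intro bounded_linear.linear bounded_linear_intros bounded_linear_Re bounded_linear_Im)
    fix \<psi> a b assume \<psi>: "\<psi> 0 = w" "jet2 \<psi> a b"
    have sq: "jet2 (\<lambda>t. (h (\<psi> t))\<^sup>2) (2 * h w * h a) (2 * (h a)\<^sup>2 + 2 * h w * h b)"
      if "bounded_linear h" for h :: "complex \<Rightarrow> real"
    proof -
      have "\<forall>\<^sub>F x in nhds (h (\<psi> 0)). ((\<lambda>x. x\<^sup>2) has_real_derivative 2 * x) (at x)"
        by (intro always_eventually allI) (auto intro!: derivative_eq_intros)
      moreover have "((\<lambda>x. 2 * x) has_real_derivative 2) (at (h (\<psi> 0)))"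
        by (auto intro!: derivative_eq_intros)
      ultimately show ?thesis
        unfolding \<psi>(1)[symmetric] by (rule jet2_compose[OF jet2_bounded_linear[OF that \<psi>(2)]])
    qed
    have "jet2 (\<lambda>t. N (\<psi> t)) (n a) (2 * N a + n b)"
      unfolding N_def n_def
      using jet2_add[OF sq[OF bounded_linear_Im] jet2_bounded_linear[OF bounded_linear_mult_right sq[OF bounded_linear_Re], of L]]
      by (simp add: algebra_simps)
    from jet2_compose[OF this, of "\<lambda>x. x powr (p / 2)" "\<lambda>x. p / 2 * x powr (p / 2 - 1)" "p / 2 * ((p / 2 - 1) * N w powr (p / 2 - 2))"]
    have "jet2 (\<lambda>t. N (\<psi> t) powr (p / 2)) (p / 2 * N w powr (p / 2 - 1) * n a)
        (p / 2 * ((p / 2 - 1) * N w powr (p / 2 - 2)) * (n a)\<^sup>2 + p / 2 * N w powr (p / 2 - 1) * (2 * N a + n b))"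
      unfolding \<psi>(1)
    proof this
      show "\<forall>\<^sub>F x in nhds (N w). ((\<lambda>x. x powr (p / 2)) has_real_derivative p / 2 * x powr (p / 2 - 1)) (at x)"
        by (rule eventually_mono[OF eventually_nhds_in_open[of "{0<..}"]])
          (use N in \<open>auto intro!: derivative_eq_intros\<close>)
      show "((\<lambda>x. p / 2 * x powr (p / 2 - 1)) has_real_derivative p / 2 * ((p / 2 - 1) * N w powr (p / 2 - 2))) (at (N w))"
        using N by (auto intro!: derivative_eq_intros)
    qed
    then show "jet2 (\<lambda>t. N (\<psi> t) powr (p / 2)) (p / 2 * N w powr (p / 2 - 1) * n a)
        (q a + p / 2 * N w powr (p / 2 - 1) * n b)"
      by (simp add: q_def algebra_simps add_divide_distrib)
  qed
  moreover have "p * N w powr (p / 2 - 1) * N a \<le> q a" for a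
    using p by (simp add: q_def)
  ultimately show ?thesis by blast
qed

subsection \<open>The inequality in the sector\<close>

text \<open>Numerator and denominator both vanish at \<theta>, so the limit is the quotient of their
  derivatives. It is the constant that later becomes \<open>cone_coeff\<close>.\<close>

lemma sector_quotient_tendsto:
  fixes p :: real
  assumes p: "p > 2"
  defines "\<theta> \<equiv> pi / (2 * p)"
  shows "((\<lambda>s. (cos s powr p - cot \<theta> powr p * sin s powr p) / cos (p * s)) \<longlongrightarrow> cos \<theta> powr (p - 1) / sin \<theta>) (at \<theta>)"
proof -
  define m where "m s = cos s powr p - cot \<theta> powr p * sin s powr p" for s
  have \<theta>: "0 < \<theta>" "\<theta> < pi / 2" "p * \<theta> = pi / 2" using p by (auto simp: \<theta>_def field_simps)
  then have pos: "sin \<theta> > 0" "cos \<theta> > 0"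
    by (auto intro: sin_gt_zero_02 cos_gt_zero sin_gt_zero2)
  have cp: "cot \<theta> powr p * sin \<theta> powr p = cos \<theta> powr p"
    using pos by (simp add: cot_def powr_mult[symmetric])
  then have m0: "m \<theta> = 0" by (simp add: m_def)
  have "cot \<theta> powr p * sin \<theta> powr (p - 1) * cos \<theta> = cos \<theta> powr p * cos \<theta> / sin \<theta>"
    unfolding cp[symmetric] using pos by (simp add: powr_diff)
  moreover have "cos \<theta> powr (p - 1) * sin \<theta> + cos \<theta> powr p * cos \<theta> / sin \<theta> = cos \<theta> powr (p - 1) / sin \<theta>"
  proof -
    have "cos \<theta> powr p = cos \<theta> powr (p - 1) * cos \<theta>" using pos by (simp add: powr_diff)
    moreover have "a * S + a * C * C / S = a * (S\<^sup>2 + C\<^sup>2) / S" if "S \<noteq> 0" for a S C :: real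
      using that by (simp add: field_simps power2_eq_square)
    ultimately show ?thesis using pos by simp
  qed
  moreover have "(m has_real_derivative
      - p * (cos \<theta> powr (p - 1) * sin \<theta> + cot \<theta> powr p * sin \<theta> powr (p - 1) * cos \<theta>)) (at \<theta>)"
    unfolding m_def using pos by (auto intro!: derivative_eq_intros simp: algebra_simps)
  ultimately have "(m has_real_derivative - p * (cos \<theta> powr (p - 1) / sin \<theta>)) (at \<theta>)" by simp
  then have 1: "((\<lambda>s. (m s - m \<theta>) / (s - \<theta>)) \<longlongrightarrow> - p * (cos \<theta> powr (p - 1) / sin \<theta>)) (at \<theta>)"
    by (simp add: has_field_derivative_iff)
  have "((\<lambda>s. cos (p * s)) has_real_derivative - (sin (p * \<theta>) * p)) (at \<theta>)"
    by (auto intro!: derivative_eq_intros)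
  then have "((\<lambda>s. cos (p * s)) has_real_derivative - p) (at \<theta>)"
    by (simp add: \<theta>)
  then have 2: "((\<lambda>s. (cos (p * s) - cos (p * \<theta>)) / (s - \<theta>)) \<longlongrightarrow> - p) (at \<theta>)"
    by (simp add: has_field_derivative_iff)
  have "((\<lambda>s. ((m s - m \<theta>) / (s - \<theta>)) / ((cos (p * s) - cos (p * \<theta>)) / (s - \<theta>))) \<longlongrightarrow>
      - p * (cos \<theta> powr (p - 1) / sin \<theta>) / - p) (at \<theta>)"
    by (rule tendsto_divide[OF 1 2]) (use p in simp)
  then have "((\<lambda>s. ((m s - m \<theta>) / (s - \<theta>)) / ((cos (p * s) - cos (p * \<theta>)) / (s - \<theta>))) \<longlongrightarrow>
      cos \<theta> powr (p - 1) / sin \<theta>) (at \<theta>)" using p by simp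
  then have "((\<lambda>s. m s / cos (p * s)) \<longlongrightarrow> cos \<theta> powr (p - 1) / sin \<theta>) (at \<theta>)"
    by (rule Lim_transform_eventually) (auto simp: eventually_at_filter m0 \<theta>)
  then show ?thesis by (simp add: m_def)
qed

text \<open>Up to a negative factor, the difference of the two sides is the derivative of the quotient in
  \<open>sector_quotient_tendsto\<close>. It vanishes at \<open>0\<close> and at \<open>\<theta>\<close>, and its own derivative changes sign only
  once in between.\<close>

lemma sector_quotient_derivative_sign:
  fixes p :: real
  assumes p: "p > 2"
  defines "\<theta> \<equiv> pi / (2 * p)"
  assumes s: "0 < s" "s \<le> 2 * \<theta>"
  shows "cot \<theta> powr p * sin s powr (p - 1) * cos ((p - 1) * s) \<le> cos s powr (p - 1) * sin ((p - 1) * s)"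
proof -
  define V where "V s = cot \<theta> powr p * sin s powr (p - 1) * cos ((p - 1) * s) - cos s powr (p - 1) * sin ((p - 1) * s)" for s
  \<comment> \<open>The derivative of V is (p - 1) * \<kappa> t * cos (p * t). Since sin increases
    and cos decreases, \<kappa> is nondecreasing; the cosine changes sign at \<theta>.\<close>
  define \<kappa> where "\<kappa> s = cot \<theta> powr p * sin s powr (p - 2) - cos s powr (p - 2)" for s
  have \<theta>: "0 < \<theta>" "\<theta> < pi / 4" "p * \<theta> = pi / 2" using p by (auto simp: \<theta>_def field_simps)
  have pos: "sin t > 0" "cos t > 0" if "0 < t" "t \<le> 2 * \<theta>" for t
    using that \<theta> by (auto intro!: cos_gt_zero sin_gt_zero)
  have der: "(V has_real_derivative (p - 1) * (\<kappa> t * cos (p * t))) (at t)" if t: "0 < t" "t \<le> 2 * \<theta>" for t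
  proof -
    have "(V has_real_derivative
       cot \<theta> powr p * ((p - 1) * sin t powr (p - 2) * cos t * cos ((p - 1) * t) - sin t powr (p - 1) * ((p - 1) * sin ((p - 1) * t)))
       - (- (p - 1) * cos t powr (p - 2) * sin t * sin ((p - 1) * t) + cos t powr (p - 1) * ((p - 1) * cos ((p - 1) * t)))) (at t)"
      unfolding V_def using pos[OF t]
      by (auto intro!: derivative_eq_intros simp: algebra_simps diff_diff_eq)
    moreover have pw: "sin t powr (p - 1) = sin t powr (p - 2) * sin t" "cos t powr (p - 1) = cos t powr (p - 2) * cos t"
      using pos[OF t] powr_add[of _ "p - 2" 1] by auto
    moreover have ca: "cos (p * t) = cos t * cos ((p - 1) * t) - sin t * sin ((p - 1) * t)"
      using cos_add[of t "(p - 1) * t"] by (simp add: algebra_simps)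
    moreover have "cot \<theta> powr p * ((p - 1) * sin t powr (p - 2) * cos t * cos ((p - 1) * t) - sin t powr (p - 1) * ((p - 1) * sin ((p - 1) * t)))
       - (- (p - 1) * cos t powr (p - 2) * sin t * sin ((p - 1) * t) + cos t powr (p - 1) * ((p - 1) * cos ((p - 1) * t)))
       = (p - 1) * (\<kappa> t * cos (p * t))"
      unfolding \<kappa>_def pw ca by (simp add: algebra_simps)
    ultimately show ?thesis by simp
  qed
  have cont: "continuous_on {a..d} V" if "0 \<le> a" "d \<le> 2 * \<theta>" for a d
  proof -
    have nn: "sin t \<ge> 0" "cos t \<ge> 0" if "t \<in> {a..d}" for t
      using that \<open>0 \<le> a\<close> \<open>d \<le> 2 * \<theta>\<close> \<theta> by (auto intro!: cos_ge_zero sin_ge_zero)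
    show ?thesis unfolding V_def
      by (intro continuous_intros continuous_on_powr') (use p nn in auto)
  qed
  have \<kappa>_mono: "\<kappa> t \<le> \<kappa> t'" if "0 < t" "t \<le> t'" "t' \<le> 2 * \<theta>" for t t'
  proof -
    have "sin t \<le> sin t'" "cos t' \<le> cos t"
      using that \<theta> by (auto intro!: sin_monotone_2pi_le cos_monotone_0_pi_le)
    then show ?thesis unfolding \<kappa>_def
      using pos[of t] pos[of t'] that p by (intro diff_mono mult_left_mono powr_mono2) auto
  qed
  have V0: "V 0 = 0" using p by (simp add: V_def)
  have pos\<theta>: "sin \<theta> > 0" "cos \<theta> > 0" using pos[of \<theta>] \<theta> by auto
  have ct: "cot \<theta> powr p * sin \<theta> powr q = cos \<theta> powr q * cot \<theta> powr (p - q)" for q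
    using pos\<theta> by (simp add: cot_def powr_divide powr_diff field_simps)
  have V\<theta>: "V \<theta> = 0"
  proof -
    have "(p - 1) * \<theta> = pi / 2 - \<theta>" using \<theta> by (simp add: algebra_simps)
    then have "cos ((p - 1) * \<theta>) = sin \<theta>" "sin ((p - 1) * \<theta>) = cos \<theta>"
      by (simp_all add: cos_diff sin_diff)
    then show ?thesis unfolding V_def ct using pos\<theta> by (simp add: cot_def)
  qed
  \<comment> \<open>As \<theta> < pi / 4. At \<theta> the function \<kappa> equals cos \<theta> powr
    (p - 2) * ((cot \<theta>)^2 - 1), so it is nonnegative from \<theta> on and V decreases
    there.\<close>
  have "cot \<theta> \<ge> 1"
  proof -
    have "sin \<theta> \<le> sin (pi / 4)" "cos (pi / 4) \<le> cos \<theta>"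
      using \<theta> by (auto intro!: sin_monotone_2pi_le cos_monotone_0_pi_le)
    then show ?thesis using pos\<theta> by (simp add: cot_def sin_45 cos_45)
  qed
  then have \<kappa>\<theta>: "\<kappa> \<theta> \<ge> 0"
    unfolding \<kappa>_def ct using ge_one_powr_ge_zero[of "cot \<theta>" 2] pos\<theta> by simp
  have "V s \<le> 0"
  proof (cases "s \<le> \<theta>")
    case True
    have c: "cos (p * t) \<ge> 0" if "0 < t" "t \<le> \<theta>" for t
    proof -
      have "p * t \<le> p * \<theta>" using that p by simp
      moreover have "0 \<le> p * t" using that p by simp
      ultimately show ?thesis using \<theta> by (intro cos_ge_zero) auto
    qed
    show ?thesis
    \<comment> \<open>By monotonicity of \<kappa>, either V is nonincreasing on [0, s] or
      nondecreasing on [s, \<theta>]; it vanishes at both 0 and \<theta>.\<close>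
    proof (cases "\<kappa> s \<le> 0")
      case k: True
      have "V s \<le> V 0"
      proof (rule DERIV_nonpos_imp_decreasing_open[OF less_imp_le[OF s(1)]])
        show "\<exists>y. (V has_real_derivative y) (at x) \<and> y \<le> 0" if "0 < x" "x < s" for x
          using der[of x] c[of x] \<kappa>_mono[of x s] k that s True p
          by (intro exI[of _ "(p - 1) * (\<kappa> x * cos (p * x))"]) (auto simp: mult_le_0_iff)
      qed (use cont s in auto)
      then show ?thesis using V0 by simp
    next
      case k: False
      have "V s \<le> V \<theta>"
      proof (rule DERIV_nonneg_imp_increasing_open[OF True])
        show "\<exists>y. (V has_real_derivative y) (at x) \<and> y \<ge> 0" if "s < x" "x < \<theta>" for x
          using der[of x] c[of x] \<kappa>_mono[of s x] k that s True p
          by (intro exI[of _ "(p - 1) * (\<kappa> x * cos (p * x))"]) auto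
      qed (use cont s \<theta> in auto)
      then show ?thesis using V\<theta> by simp
    qed
  next
    case False
    have c: "cos (p * t) \<le> 0" if "\<theta> < t" "t \<le> 2 * \<theta>" for t
    proof -
      have "p * \<theta> \<le> p * t" "p * t \<le> p * (2 * \<theta>)" using that p by (auto intro: mult_left_mono)
      then have "0 \<le> cos (pi - p * t)" using \<theta> by (intro cos_ge_zero) auto
      then show ?thesis by simp
    qed
    have "V s \<le> V \<theta>"
    proof (rule DERIV_nonpos_imp_decreasing_open[where f = V and a = \<theta> and b = s])
      show "\<exists>y. (V has_real_derivative y) (at x) \<and> y \<le> 0" if "\<theta> < x" "x < s" for x
        using der[of x] c[of x] \<kappa>_mono[of \<theta> x] \<kappa>\<theta> that s \<theta> p
        by (intro exI[of _ "(p - 1) * (\<kappa> x * cos (p * x))"]) (auto simp: mult_le_0_iff)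
    qed (use False cont s \<theta> in auto)
    then show ?thesis using V\<theta> by simp
  qed
  then show ?thesis by (simp add: V_def)
qed

text \<open>The quotient R is nondecreasing on either side of \<theta> and tends to b there. Before
  \<theta> it is at most b and the cosine is positive; after \<theta> it is at least b and the
  cosine is negative, so multiplying out gives the same inequality. The stretch past \<theta> makes
  the harmonic piece dominate just outside the cone.\<close>

lemma sector_inequality:
  fixes p :: real
  assumes p: "p > 2"
  defines "\<theta> \<equiv> pi / (2 * p)"
  assumes s: "0 \<le> s" "s \<le> 2 * \<theta>"
  shows "cos s powr p - cot \<theta> powr p * sin s powr p \<le> cos \<theta> powr (p - 1) / sin \<theta> * cos (p * s)"
proof -
  define m where "m s = cos s powr p - cot \<theta> powr p * sin s powr p" for s
  define R where "R s = m s / cos (p * s)" for s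
  define b where "b = cos \<theta> powr (p - 1) / sin \<theta>"
  have lim: "(R \<longlongrightarrow> b) (at \<theta>)"
    using sector_quotient_tendsto[OF p] by (simp add: R_def[abs_def] m_def[abs_def] b_def \<theta>_def)
  have \<theta>: "0 < \<theta>" "\<theta> < pi / 4" "p * \<theta> = pi / 2" using p by (auto simp: \<theta>_def field_simps)
  have pos: "sin t > 0" "cos t > 0" if "0 < t" "t \<le> 2 * \<theta>" for t
    using that \<theta> by (auto intro!: cos_gt_zero sin_gt_zero)
  have der: "\<exists>y. (R has_real_derivative y) (at t) \<and> y \<ge> 0" if t: "0 < t" "t \<le> 2 * \<theta>" "cos (p * t) \<noteq> 0" for t
  proof (intro exI conjI)
    have "(m has_real_derivative - p * (cos t powr (p - 1) * sin t + cot \<theta> powr p * sin t powr (p - 1) * cos t)) (at t)"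
      unfolding m_def using pos[of t] t by (auto intro!: derivative_eq_intros simp: algebra_simps)
    moreover have "((\<lambda>t. cos (p * t)) has_real_derivative - p * sin (p * t)) (at t)"
      by (auto intro!: derivative_eq_intros)
    ultimately show "(R has_real_derivative
        (- p * (cos t powr (p - 1) * sin t + cot \<theta> powr p * sin t powr (p - 1) * cos t) * cos (p * t)
         - m t * (- p * sin (p * t))) / (cos (p * t) * cos (p * t))) (at t)"
      unfolding R_def using t(3) by (rule DERIV_divide)
    have pp: "sin t powr p = sin t powr (p - 1) * sin t" "cos t powr p = cos t powr (p - 1) * cos t"
      using pos[of t] t by (simp_all add: powr_mult_base powr_add[symmetric] mult.commute)
    have "- p * (cos t powr (p - 1) * sin t + cot \<theta> powr p * sin t powr (p - 1) * cos t) * cos (p * t)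
         - m t * (- p * sin (p * t))
       = p * (cos t powr (p - 1) * (sin (p * t) * cos t - cos (p * t) * sin t)
         - cot \<theta> powr p * sin t powr (p - 1) * (cos (p * t) * cos t + sin (p * t) * sin t))"
      unfolding m_def pp by (simp add: algebra_simps)
    also have "\<dots> = p * (cos t powr (p - 1) * sin ((p - 1) * t) - cot \<theta> powr p * sin t powr (p - 1) * cos ((p - 1) * t))"
    proof -
      have "(p - 1) * t = p * t - t" by (simp add: algebra_simps)
      then have "sin ((p - 1) * t) = sin (p * t) * cos t - cos (p * t) * sin t"
        "cos ((p - 1) * t) = cos (p * t) * cos t + sin (p * t) * sin t"
        by (simp_all only: sin_diff cos_diff)
      then show ?thesis by (simp only:)
    qed
    also have "\<dots> \<ge> 0"
      using sector_quotient_derivative_sign[OF p, of t] t p by (simp add: \<theta>_def)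
    finally show "0 \<le> (- p * (cos t powr (p - 1) * sin t + cot \<theta> powr p * sin t powr (p - 1) * cos t) * cos (p * t)
         - m t * (- p * sin (p * t))) / (cos (p * t) * cos (p * t))"
      by (intro divide_nonneg_nonneg) auto
  qed
  have cont: "continuous_on {a..d} R" if "0 \<le> a" "d \<le> 2 * \<theta>" "\<And>t. t \<in> {a..d} \<Longrightarrow> cos (p * t) \<noteq> 0" for a d
  proof -
    have "sin t \<ge> 0" "cos t \<ge> 0" if "t \<in> {a..d}" for t
      using that \<open>0 \<le> a\<close> \<open>d \<le> 2 * \<theta>\<close> \<theta> by (auto intro!: cos_ge_zero sin_ge_zero)
    then show ?thesis unfolding R_def m_def using p that
      by (intro continuous_intros continuous_on_powr') auto
  qed
  consider "s = \<theta>" | "s < \<theta>" | "\<theta> < s" by linarith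
  then have "m s \<le> b * cos (p * s)"
  proof cases
    case 1
    have "sin \<theta> > 0" "cos \<theta> > 0" using pos[of \<theta>] \<theta> by auto
    then show ?thesis unfolding 1 m_def by (simp add: \<theta> cot_def powr_divide)
  next
    case 2
    have c: "cos (p * t) > 0" if "0 \<le> t" "t < \<theta>" for t
    proof -
      have "p * t < p * \<theta>" using that p by simp
      moreover have "0 \<le> p * t" using that p by simp
      ultimately show ?thesis using \<theta> by (intro cos_gt_zero_pi) auto
    qed
    have "R s \<le> R t" if t: "s < t" "t < \<theta>" for t
    proof (rule DERIV_nonneg_imp_increasing_open[OF less_imp_le[OF t(1)]])
      show "\<exists>y. (R has_real_derivative y) (at x) \<and> y \<ge> 0" if "s < x" "x < t" for x
        using der[of x] c[of x] that s t \<theta> by auto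
      have "cos (p * x) \<noteq> 0" if "x \<in> {s..t}" for x using c[of x] that s t by auto
      then show "continuous_on {s..t} R" using s t by (intro cont) auto
    qed
    then have "\<forall>\<^sub>F t in at_left \<theta>. R s \<le> R t"
      unfolding eventually_at_left_field using 2 by blast
    moreover have "(R \<longlongrightarrow> b) (at_left \<theta>)" using lim by (simp add: filterlim_at_split)
    ultimately have "R s \<le> b" by (intro tendsto_lowerbound) auto
    then show ?thesis using c[of s] s 2 by (simp add: R_def field_simps)
  next
    case 3
    have c: "cos (p * t) < 0" if "\<theta> < t" "t \<le> s" for t
    proof -
      have "p * \<theta> < p * t" "p * t \<le> p * (2 * \<theta>)" using that p s by auto
      then have "0 < cos (pi - p * t)" using \<theta> by (intro cos_gt_zero_pi) auto
      then show ?thesis by simp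
    qed
    have "R t \<le> R s" if t: "\<theta> < t" "t < s" for t
    proof (rule DERIV_nonneg_imp_increasing_open[OF less_imp_le[OF t(2)]])
      show "\<exists>y. (R has_real_derivative y) (at x) \<and> y \<ge> 0" if "t < x" "x < s" for x
        using der[of x] c[of x] that s t \<theta> by auto
      have "cos (p * x) \<noteq> 0" if "x \<in> {t..s}" for x using c[of x] that s t by auto
      then show "continuous_on {t..s} R" using s t \<theta> by (intro cont) auto
    qed
    then have "\<forall>\<^sub>F t in at_right \<theta>. R t \<le> R s"
      unfolding eventually_at_right_field using 3 by blast
    moreover have "(R \<longlongrightarrow> b) (at_right \<theta>)" using lim by (simp add: filterlim_at_split)
    ultimately have "b \<le> R s" by (intro tendsto_upperbound) auto
    then show ?thesis using c[of s] 3 by (simp add: R_def field_simps)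
  qed
  then show ?thesis by (simp add: m_def b_def)
qed

subsection \<open>The barrier\<close>

definition cone_slope :: "real \<Rightarrow> real" where
  "cone_slope p = cot (pi / (2 * p))"

definition cone_coeff :: "real \<Rightarrow> real" where
  "cone_coeff p = cos (pi / (2 * p)) powr (p - 1) / sin (pi / (2 * p))"

text \<open>\<open>rotated w\<close> is \<open>w / \<i>\<close> in the upper and \<open>- w / \<i>\<close> in the lower half plane, so that the cone
  \<open>cone_slope p * \<bar>Re w\<bar> \<le> \<bar>Im w\<bar>\<close> around the imaginary axis becomes the sector
  \<open>\<bar>Arg\<bar> \<le> pi / (2 * p)\<close>, where \<open>Re (w powr p)\<close> is nonnegative.\<close>

definition rotated :: "complex \<Rightarrow> complex" where
  "rotated w = - \<i> * of_real (sgn (Im w)) * w"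

definition barrier :: "real \<Rightarrow> complex \<Rightarrow> real" where
  "barrier p w =
     (if cone_slope p * \<bar>Re w\<bar> \<le> \<bar>Im w\<bar> then cone_coeff p * Re (rotated w powr of_real p)
      else \<bar>Im w\<bar> powr p - cone_slope p powr p * \<bar>Re w\<bar> powr p)"

lemma half_angle_bounds:
  assumes "p > 2"
  shows "0 < pi / (2 * p)" "pi / (2 * p) < pi / 4" "0 < sin (pi / (2 * p))" "0 < cos (pi / (2 * p))"
proof -
  show *: "0 < pi / (2 * p)" "pi / (2 * p) < pi / 4" using assms by (auto simp: field_simps)
  show "0 < sin (pi / (2 * p))" "0 < cos (pi / (2 * p))"
    using * by (auto intro!: sin_gt_zero cos_gt_zero simp del: zero_less_divide_iff)
qed

lemma cone_slope_ge_1: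
  assumes "p > 2"
  shows "1 \<le> cone_slope p"
proof -
  have "sin (pi / (2 * p)) \<le> sin (pi / 4)" "cos (pi / 4) \<le> cos (pi / (2 * p))"
    using half_angle_bounds[OF assms] by (auto intro!: sin_monotone_2pi_le cos_monotone_0_pi_le simp del: zero_less_divide_iff)
  then show ?thesis using half_angle_bounds[OF assms]
    by (simp add: cone_slope_def cot_def sin_45 cos_45 le_divide_eq)
qed

lemma cone_coeff_pos: "p > 2 \<Longrightarrow> 0 < cone_coeff p"
  using half_angle_bounds[of p] by (simp add: cone_coeff_def)

lemma Re_rotated [simp]: "Re (rotated w) = \<bar>Im w\<bar>"
  by (auto simp: rotated_def sgn_if)

lemma abs_Im_rotated: "Im w \<noteq> 0 \<Longrightarrow> \<bar>Im (rotated w)\<bar> = \<bar>Re w\<bar>"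
  by (auto simp: rotated_def sgn_if)

lemma norm_rotated: "cmod (rotated w) \<le> cmod w"
  by (auto simp: rotated_def norm_mult sgn_if)

lemma polar_right_half_plane:
  assumes "0 < Re w"
  defines "s \<equiv> \<bar>Im (Ln w)\<bar>"
  shows "0 \<le> s" "s < pi / 2" "Re w = cmod w * cos s" "\<bar>Im w\<bar> = cmod w * sin s"
    "Re (w powr of_real p) = cmod w powr p * cos (p * s)"
proof -
  have w: "w \<noteq> 0" using assms by auto
  show s: "0 \<le> s" "s < pi / 2" using Re_Ln_pos_lt[OF w] assms(1) by (auto simp: s_def)
  have e: "exp (Ln w) = w" "exp (Re (Ln w)) = cmod w" using w by simp_all
  have "Re w = cmod w * cos (Im (Ln w))" "Im w = cmod w * sin (Im (Ln w))"
    using Re_exp[of "Ln w"] Im_exp[of "Ln w"] unfolding e by auto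
  moreover have "cos s = cos (Im (Ln w))" by (simp add: s_def abs_if)
  moreover have "\<bar>sin (Im (Ln w))\<bar> = sin s"
  proof -
    have "sin s \<ge> 0" using s by (intro sin_ge_zero) auto
    then show ?thesis by (auto simp: s_def abs_if split: if_splits)
  qed
  ultimately show "Re w = cmod w * cos s" "\<bar>Im w\<bar> = cmod w * sin s"
    by (auto simp: abs_mult)
  show "Re (w powr of_real p) = cmod w powr p * cos (p * s)"
    using w by (simp add: powr_def Re_exp s_def abs_if)
qed

text \<open>Both sides are homogeneous of degree p, so only the angle matters.\<close>

lemma core_inequality:
  assumes p: "p > 2" and w: "0 < Re w" "\<bar>Im (Ln w)\<bar> \<le> 2 * (pi / (2 * p))"
  shows "Re w powr p - cone_slope p powr p * \<bar>Im w\<bar> powr p \<le> cone_coeff p * Re (w powr of_real p)"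
proof -
  define s where "s = \<bar>Im (Ln w)\<bar>"
  note pol = polar_right_half_plane[OF w(1), folded s_def]
  have pos: "cos s \<ge> 0" "sin s \<ge> 0" using pol(1,2) by (auto intro!: cos_ge_zero sin_ge_zero)
  have "Re w powr p - cone_slope p powr p * \<bar>Im w\<bar> powr p
      = cmod w powr p * (cos s powr p - cone_slope p powr p * sin s powr p)"
    unfolding pol(3,4) using pos by (simp add: powr_mult algebra_simps)
  also have "\<dots> \<le> cmod w powr p * (cone_coeff p * cos (p * s))"
    using sector_inequality[OF p pol(1)] w(2)
    by (intro mult_left_mono) (auto simp: cone_slope_def cone_coeff_def s_def)
  also have "\<dots> = cone_coeff p * Re (w powr of_real p)" by (simp add: pol(5))
  finally show ?thesis .
qed

lemma angle_le_in_cone: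
  assumes p: "p > 2" and w: "0 < Re w" "cone_slope p * \<bar>Im w\<bar> \<le> Re w"
  shows "\<bar>Im (Ln w)\<bar> \<le> pi / (2 * p)"
proof (rule ccontr)
  assume neg: "\<not> ?thesis"
  define s \<theta> where "s = \<bar>Im (Ln w)\<bar>" and "\<theta> = pi / (2 * p)"
  note pol = polar_right_half_plane[OF w(1), folded s_def]
  note \<theta> = half_angle_bounds[OF p, folded \<theta>_def]
  have "cos \<theta> / sin \<theta> * (cmod w * sin s) \<le> cmod w * cos s"
    using w(2) pol(3,4) by (simp add: cone_slope_def cot_def \<theta>_def)
  then have "cmod w * (cos \<theta> * sin s) \<le> cmod w * (sin \<theta> * cos s)"
    using \<theta>(3) by (simp add: field_simps)
  moreover have "cmod w > 0" using w(1) by auto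
  ultimately have "sin (s - \<theta>) \<le> 0" by (simp add: sin_diff mult.commute)
  moreover have "sin (s - \<theta>) > 0"
    using neg pol(1,2) \<theta> by (intro sin_gt_zero) (auto simp: s_def \<theta>_def)
  ultimately show False by simp
qed

lemma barrier_ge:
  assumes p: "p > 2"
  shows "\<bar>Im w\<bar> powr p - cone_slope p powr p * \<bar>Re w\<bar> powr p \<le> barrier p w"
proof (cases "cone_slope p * \<bar>Re w\<bar> \<le> \<bar>Im w\<bar>")
  case True
  show ?thesis
  proof (cases "Im w = 0")
    \<comment> \<open>In the cone a real w must be 0. There \<open>sgn 0 = 0\<close> makes
      \<open>rotated w\<close> zero, and \<open>0 powr _\<close> is 0.\<close>
    case im: True
    then have "Re w = 0" using True cone_slope_ge_1[OF p] by (simp add: mult_le_0_iff)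
    then have "w = 0" using im by (simp add: complex_eq_iff)
    then show ?thesis by (simp add: barrier_def rotated_def)
  next
    case False
    have "\<bar>Im (Ln (rotated w))\<bar> \<le> pi / (2 * p)"
      by (rule angle_le_in_cone[OF p]) (use False True in \<open>simp_all add: abs_Im_rotated\<close>)
    then show ?thesis
      using core_inequality[OF p, of "rotated w"] False True half_angle_bounds(1)[OF p]
      by (simp add: barrier_def abs_Im_rotated)
  qed
qed (simp add: barrier_def)

text \<open>This starts the mean value inequality, at w = f 0. Only the edge needs an argument:
  there the angle is exactly pi / (2 * p), which makes the cosine vanish.\<close>

lemma barrier_nonpos:
  assumes p: "p > 2" and w: "\<bar>Im w\<bar> \<le> cone_slope p * \<bar>Re w\<bar>"
  shows "barrier p w \<le> 0"
proof (cases "cone_slope p * \<bar>Re w\<bar> \<le> \<bar>Im w\<bar>")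
  case True
  with w have eq: "\<bar>Im w\<bar> = cone_slope p * \<bar>Re w\<bar>" by simp
  show ?thesis
  proof (cases "Im w = 0")
    case True
    then have "w = 0" using eq cone_slope_ge_1[OF p] by (simp add: complex_eq_iff)
    then show ?thesis by (simp add: barrier_def rotated_def)
  next
    case False
    define \<omega> where "\<omega> = rotated w"
    define s \<theta> where "s = \<bar>Im (Ln \<omega>)\<bar>" and "\<theta> = pi / (2 * p)"
    have \<omega>: "0 < Re \<omega>" "Re \<omega> = cone_slope p * \<bar>Im \<omega>\<bar>"
      using False eq by (simp_all add: \<omega>_def abs_Im_rotated)
    note pol = polar_right_half_plane[OF \<omega>(1), folded s_def]
    note \<theta> = half_angle_bounds[OF p, folded \<theta>_def]
    have "cmod \<omega> * cos s = cos \<theta> / sin \<theta> * (cmod \<omega> * sin s)"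
      using \<omega>(2) pol(3,4) by (simp add: cone_slope_def cot_def \<theta>_def)
    then have "cmod \<omega> * (cos \<theta> * sin s) = cmod \<omega> * (sin \<theta> * cos s)"
      using \<theta>(3) by (auto simp: field_simps)
    moreover have "cmod \<omega> > 0" using \<omega>(1) by auto
    \<comment> \<open>Both angles lie in [0, pi / 2), so a vanishing sine of the difference
      identifies them.\<close>
    ultimately have "sin (s - \<theta>) = 0" by (simp add: sin_diff mult.commute)
    moreover have "sin (s - \<theta>) > 0" if "s > \<theta>"
      using that pol(1,2) \<theta> by (intro sin_gt_zero) auto
    moreover have "sin (\<theta> - s) > 0" if "s < \<theta>"
      using that pol(1,2) \<theta> by (intro sin_gt_zero) auto
    moreover have "sin (\<theta> - s) = - sin (s - \<theta>)"
      by (simp add: sin_diff)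
    ultimately have "\<theta> = s" by (metis linorder_neqE less_irrefl neg_equal_0_iff_equal)
    then have ps: "p * s = pi / 2" using p by (auto simp: \<theta>_def)
    have "Re (\<omega> powr of_real p) = 0" unfolding pol(5) ps by simp
    then show ?thesis using True by (simp add: barrier_def \<omega>_def True)
  qed
next
  case False
  have "\<bar>Im w\<bar> powr p \<le> (cone_slope p * \<bar>Re w\<bar>) powr p"
    using p w by (intro powr_mono2) auto
  also have "\<dots> = cone_slope p powr p * \<bar>Re w\<bar> powr p"
    using cone_slope_ge_1[OF p] by (simp add: powr_mult)
  finally show ?thesis using False by (simp add: barrier_def)
qed

text \<open>Growth of order p > 2 makes the barrier of smaller order than t^2 along a map near one
  of its zeros.\<close>

lemma barrier_abs_le:
  assumes p: "p > 2"
  shows "\<bar>barrier p w\<bar> \<le> (cone_coeff p + 1 + cone_slope p powr p) * cmod w powr p"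
proof (cases "cone_slope p * \<bar>Re w\<bar> \<le> \<bar>Im w\<bar>")
  case True
  have "\<bar>Re (rotated w powr of_real p)\<bar> \<le> cmod (rotated w powr of_real p)" by (rule abs_Re_le_cmod)
  also have "\<dots> = cmod (rotated w) powr p" by (simp add: norm_powr_real_powr')
  also have "\<dots> \<le> cmod w powr p" using p norm_rotated by (intro powr_mono2) auto
  finally have "\<bar>barrier p w\<bar> \<le> cone_coeff p * cmod w powr p"
    using True cone_coeff_pos[OF p] by (simp add: barrier_def abs_mult)
  also have "\<dots> \<le> (cone_coeff p + 1 + cone_slope p powr p) * cmod w powr p"
    by (intro mult_right_mono) auto
  finally show ?thesis .
next
  case False
  have "\<bar>Im w\<bar> powr p \<le> cmod w powr p" "\<bar>Re w\<bar> powr p \<le> cmod w powr p"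
    using p abs_Im_le_cmod abs_Re_le_cmod by (auto intro!: powr_mono2)
  then have "\<bar>barrier p w\<bar> \<le> cmod w powr p + cone_slope p powr p * cmod w powr p"
    using False mult_left_mono[of "\<bar>Re w\<bar> powr p" "cmod w powr p" "cone_slope p powr p"]
    by (simp add: barrier_def abs_le_iff) (smt (verit) powr_ge_zero mult_nonneg_nonneg)
  also have "\<dots> \<le> (cone_coeff p + 1 + cone_slope p powr p) * cmod w powr p"
    using cone_coeff_pos[OF p] by (simp add: algebra_simps)
  finally show ?thesis .
qed

lemma eventually_rotated:
  assumes "Im w \<noteq> 0"
  shows "\<forall>\<^sub>F x in nhds w. rotated x = - \<i> * of_real (sgn (Im w)) * x"
proof -
  have "\<forall>\<^sub>F x in nhds w. 0 < sgn (Im w) * Im x"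
  proof (rule eventually_nhds_in_open[of "{x. 0 < sgn (Im w) * Im x}", simplified])
    show "open {x. 0 < sgn (Im w) * Im x}" by (intro open_Collect_less continuous_intros)
    show "0 < sgn (Im w) * Im w" using assms by (simp add: sgn_if)
  qed
  then show ?thesis
    by eventually_elim (auto simp: rotated_def sgn_if split: if_splits)
qed

text \<open>Off the origin the cone avoids the real axis, where \<open>sgn (Im w)\<close> jumps and
  the branch cut could be met. At the origin the bound by \<bar>w\<bar> powr p takes over.\<close>

lemma continuous_rotated_powr:
  assumes p: "p > 2"
  shows "continuous_on {w. cone_slope p * \<bar>Re w\<bar> \<le> \<bar>Im w\<bar>} (\<lambda>w. Re (rotated w powr of_real p))"
proof (rule continuous_at_imp_continuous_on, rule ballI)
  fix w assume w: "w \<in> {w. cone_slope p * \<bar>Re w\<bar> \<le> \<bar>Im w\<bar>}"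
  show "isCont (\<lambda>w. Re (rotated w powr of_real p)) w"
  proof (cases "Im w = 0")
    case True
    then have "w = 0" using w cone_slope_ge_1[OF p] by (simp add: complex_eq_iff mult_le_0_iff)
    have "((\<lambda>w. Re (rotated w powr of_real p)) \<longlongrightarrow> 0) (at 0)"
    proof (rule tendsto_0_le)
      show "((\<lambda>w. cmod w powr p) \<longlongrightarrow> 0) (at 0)"
        using p by (intro tendsto_zero_powrI) (auto intro!: tendsto_eq_intros)
      have "\<bar>Re (rotated w powr of_real p)\<bar> \<le> cmod w powr p" for w
      proof -
        have "\<bar>Re (rotated w powr of_real p)\<bar> \<le> cmod (rotated w powr of_real p)" by (rule abs_Re_le_cmod)
        also have "\<dots> = cmod (rotated w) powr p" by (simp add: norm_powr_real_powr')
        also have "\<dots> \<le> cmod w powr p" using p norm_rotated by (intro powr_mono2) auto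
        finally show ?thesis .
      qed
      then show "\<forall>\<^sub>F w in at 0. norm (Re (rotated w powr of_real p)) \<le> norm (cmod w powr p) * 1"
        by (intro always_eventually) simp
    qed
    then show ?thesis by (simp add: isCont_def \<open>w = 0\<close> rotated_def)
  next
    case False
    define k where "k = - \<i> * of_real (sgn (Im w))"
    have "Re (k * w) > 0" using False by (auto simp: k_def sgn_if)
    then have "k * w \<notin> \<real>\<^sub>\<le>\<^sub>0" by (auto simp: complex_nonpos_Reals_iff)
    then have "((\<lambda>x. (k * x) powr of_real p) has_field_derivative
        of_real p * (k * w) powr (of_real p - 1) * k) (at w)"
      by (auto intro!: derivative_eq_intros)
    then have "isCont (\<lambda>x. Re ((k * x) powr of_real p)) w"
      by (intro continuous_Re DERIV_isCont)
    moreover have "\<forall>\<^sub>F x in nhds w. Re (rotated x powr of_real p) = Re ((k * x) powr of_real p)"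
      using eventually_rotated[OF False] by eventually_elim (simp add: k_def)
    ultimately show ?thesis using isCont_cong by fast
  qed
qed

lemma continuous_on_barrier:
  assumes p: "p > 2"
  shows "continuous_on UNIV (barrier p)"
proof -
  have "continuous_on ({w. cone_slope p * \<bar>Re w\<bar> \<le> \<bar>Im w\<bar>} \<union> {w. \<bar>Im w\<bar> \<le> cone_slope p * \<bar>Re w\<bar>})
     (\<lambda>w. if cone_slope p * \<bar>Re w\<bar> \<le> \<bar>Im w\<bar> then cone_coeff p * Re (rotated w powr of_real p)
      else \<bar>Im w\<bar> powr p - cone_slope p powr p * \<bar>Re w\<bar> powr p)"
  proof (rule continuous_on_If)
    show "closed {w. cone_slope p * \<bar>Re w\<bar> \<le> \<bar>Im w\<bar>}" "closed {w. \<bar>Im w\<bar> \<le> cone_slope p * \<bar>Re w\<bar>}"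
      by (intro closed_Collect_le continuous_intros)+
    show "continuous_on {w. cone_slope p * \<bar>Re w\<bar> \<le> \<bar>Im w\<bar>} (\<lambda>w. cone_coeff p * Re (rotated w powr of_real p))"
      by (intro continuous_on_mult_left continuous_rotated_powr p)
    show "continuous_on {w. \<bar>Im w\<bar> \<le> cone_slope p * \<bar>Re w\<bar>}
        (\<lambda>w. \<bar>Im w\<bar> powr p - cone_slope p powr p * \<bar>Re w\<bar> powr p)"
      using p by (intro continuous_intros continuous_on_powr') auto
  next
    fix w assume "w \<in> {w. \<bar>Im w\<bar> \<le> cone_slope p * \<bar>Re w\<bar>}" and P: "cone_slope p * \<bar>Re w\<bar> \<le> \<bar>Im w\<bar>"
    then have eq: "\<bar>Im w\<bar> = cone_slope p * \<bar>Re w\<bar>" by simp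
    \<comment> \<open>The minorant is 0 on the edge, and \<open>barrier_ge\<close> with
      \<open>barrier_nonpos\<close> squeezes the harmonic piece to 0 as well.\<close>
    have "\<bar>Im w\<bar> powr p - cone_slope p powr p * \<bar>Re w\<bar> powr p = 0"
      unfolding eq using cone_slope_ge_1[OF p] by (simp add: powr_mult)
    then show "cone_coeff p * Re (rotated w powr of_real p) = \<bar>Im w\<bar> powr p - cone_slope p powr p * \<bar>Re w\<bar> powr p"
      using barrier_nonpos[OF p, of w] barrier_ge[OF p, of w] eq P by (simp add: barrier_def)
  qed auto
  moreover have "{w. cone_slope p * \<bar>Re w\<bar> \<le> \<bar>Im w\<bar>} \<union> {w. \<bar>Im w\<bar> \<le> cone_slope p * \<bar>Re w\<bar>} = UNIV"
    by auto
  ultimately show ?thesis by (simp add: barrier_def[abs_def])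
qed

text \<open>The two pieces of the barrier only match to first order on the boundary of the cone. There the
  harmonic piece lies above the other one on both sides, so touching from above is unaffected.\<close>

lemma barrier_touching_cone:
  assumes p: "p > 2" and w: "w \<noteq> 0" "cone_slope p * \<bar>Re w\<bar> \<le> \<bar>Im w\<bar>"
  defines "k \<equiv> - \<i> * of_real (sgn (Im w))"
  shows "\<forall>\<^sub>F x in nhds w. barrier p x \<le> cone_coeff p * Re ((k * x) powr of_real p)"
    and "0 < Re (k * w)" and "barrier p w = cone_coeff p * Re ((k * w) powr of_real p)"
    and "k\<^sup>2 = -1"
proof -
  have im: "Im w \<noteq> 0"
    using w cone_slope_ge_1[OF p] by (auto simp: complex_eq_iff mult_le_0_iff)
  show pos: "0 < Re (k * w)" using im by (auto simp: k_def sgn_if)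
  have kw: "k * w = rotated w" by (simp add: k_def rotated_def)
  show "barrier p w = cone_coeff p * Re ((k * w) powr of_real p)"
    using w by (simp add: barrier_def kw)
  show "k\<^sup>2 = -1" using im by (simp add: k_def power_mult_distrib sgn_if)
  have "\<bar>Im (Ln (k * w))\<bar> \<le> pi / (2 * p)"
    unfolding kw by (rule angle_le_in_cone[OF p]) (use im w in \<open>simp_all add: abs_Im_rotated\<close>)
  \<comment> \<open>The factor 2 leaves room: the angle is at most pi / (2 * p) at w, so by
    continuity it stays in the range of \<open>core_inequality\<close> on a full neighbourhood,
    outside the cone too.\<close>
  then have lt: "\<bar>Im (Ln (k * w))\<bar> < 2 * (pi / (2 * p))" using half_angle_bounds(1)[OF p] by linarith
  have "k * w \<notin> \<real>\<^sub>\<le>\<^sub>0" using pos by (auto simp: complex_nonpos_Reals_iff)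
  then have "isCont (\<lambda>x. \<bar>Im (Ln (k * x))\<bar>) w" by (intro continuous_intros isCont_Ln') auto
  then have "((\<lambda>x. \<bar>Im (Ln (k * x))\<bar>) \<longlongrightarrow> \<bar>Im (Ln (k * w))\<bar>) (nhds w)"
    using tendsto_at_iff_tendsto_nhds[of "\<lambda>x. \<bar>Im (Ln (k * x))\<bar>" w] by (simp add: isCont_def)
  then have "\<forall>\<^sub>F x in nhds w. \<bar>Im (Ln (k * x))\<bar> < 2 * (pi / (2 * p))"
    using lt by (rule order_tendstoD)
  moreover have "open {x. 0 < Re (k * x)}" by (intro open_Collect_less continuous_intros)
  then have "\<forall>\<^sub>F x in nhds w. x \<in> {x. 0 < Re (k * x)}"
    using pos by (intro eventually_nhds_in_open) auto
  then have "\<forall>\<^sub>F x in nhds w. 0 < Re (k * x)" by eventually_elim simp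
  ultimately show "\<forall>\<^sub>F x in nhds w. barrier p x \<le> cone_coeff p * Re ((k * x) powr of_real p)"
    using eventually_rotated[OF im]
  proof eventually_elim
    case (elim x)
    then have r: "k * x = rotated x" by (simp add: k_def)
    have "Im x \<noteq> 0" using elim(2) by (simp add: r)
    then show ?case
      using core_inequality[OF p elim(2)] elim(1) unfolding r
      by (simp add: barrier_def abs_Im_rotated)
  qed
qed

lemma barrier_eventually_outside:
  assumes w: "\<bar>Im w\<bar> < cone_slope p * \<bar>Re w\<bar>"
  shows "\<forall>\<^sub>F x in nhds w. barrier p x = \<bar>Im x\<bar> powr p - cone_slope p powr p * \<bar>Re x\<bar> powr p"
proof -
  have "open {x. \<bar>Im x\<bar> < cone_slope p * \<bar>Re x\<bar>}" by (intro open_Collect_less continuous_intros)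
  then have "\<forall>\<^sub>F x in nhds w. x \<in> {x. \<bar>Im x\<bar> < cone_slope p * \<bar>Re x\<bar>}"
    using w by (intro eventually_nhds_in_open) auto
  then show ?thesis by eventually_elim (simp add: barrier_def)
qed

section \<open>The barrier composed with a harmonic quasiregular map\<close>

lemma jet2_zero_linear_bound:
  assumes "jet2 \<phi> a b" "\<phi> 0 = 0"
  shows "\<forall>\<^sub>F t in nhds 0. norm (\<phi> t) \<le> (norm a + 1) * \<bar>t\<bar>"
proof -
  obtain \<phi>' where ev: "\<forall>\<^sub>F t in nhds 0. (\<phi> has_vector_derivative \<phi>' t) (at t)" and r: "\<phi>' 0 = a"
    using assms(1) by (auto simp: jet2_def)
  have "(\<phi> has_derivative (\<lambda>t. t *\<^sub>R a)) (at 0)"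
    using eventually_nhds_x_imp_x[OF ev] r by (simp add: has_vector_derivative_def)
  then obtain e where e: "e > 0" "\<And>t. \<bar>t\<bar> < e \<Longrightarrow> norm (\<phi> t - t *\<^sub>R a) \<le> 1 * \<bar>t\<bar>"
    unfolding has_derivative_at_alt using assms(2) by (metis diff_zero real_norm_def zero_less_one)
  show ?thesis unfolding eventually_nhds_metric
  proof (intro exI[of _ e] conjI allI impI)
    fix t :: real assume "dist t 0 < e"
    then have "norm (\<phi> t - t *\<^sub>R a) \<le> \<bar>t\<bar>" using e(2) by simp
    then have "norm (\<phi> t) \<le> norm (t *\<^sub>R a) + \<bar>t\<bar>"
      using norm_triangle_sub[of "\<phi> t" "t *\<^sub>R a"] by simp
    then show "norm (\<phi> t) \<le> (norm a + 1) * \<bar>t\<bar>" by (simp add: algebra_simps)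
  qed (rule e)
qed

lemma eventually_at_right_of_nhds_abs:
  assumes "\<forall>\<^sub>F t in nhds (0::real). P t"
  shows "\<forall>\<^sub>F t in at_right 0. P t \<and> P (- t)"
proof -
  obtain e where "e > 0" "\<And>t. \<bar>t\<bar> < e \<Longrightarrow> P t"
    using assms unfolding eventually_nhds_metric by auto
  then show ?thesis unfolding eventually_at_right_field by (intro exI[of _ e]) auto
qed

text \<open>At a zero f is O(t) on the stencil, so F \<circ> f is O(t powr p), which is o(t^2)
  because p > 2.\<close>

lemma laplacian_le_at_zero:
  assumes f: "harmonic_on S f" "open S" "z \<in> S" "f z = (0::complex)"
    and p: "p > 2" and F: "\<And>w. \<bar>F w\<bar> \<le> M * cmod w powr p"
  shows "laplacian_le (\<lambda>x. F (f x)) z 0"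
proof -
  define B where "B = max (cmod (dx f z)) (cmod (dy f z)) + 1"
  have B: "B > 0" unfolding B_def by (smt (verit) norm_ge_zero)
  have M: "M \<ge> 0" using F[of 1] by simp
  have F0: "F 0 = 0" using F[of 0] by simp
  have "\<forall>\<^sub>F t in nhds 0. cmod (f (z + of_real t)) \<le> (cmod (dx f z) + 1) * \<bar>t\<bar>"
    "\<forall>\<^sub>F t in nhds 0. cmod (f (z + \<i> * of_real t)) \<le> (cmod (dy f z) + 1) * \<bar>t\<bar>"
    using jet2_zero_linear_bound[OF harmonic_on_jet2(1)[OF f(1-3)]]
      jet2_zero_linear_bound[OF harmonic_on_jet2(2)[OF f(1-3)]] f(4) by simp_all
  then have ev: "\<forall>\<^sub>F t in nhds 0. cmod (f (z + of_real t)) \<le> B * \<bar>t\<bar> \<and> cmod (f (z + \<i> * of_real t)) \<le> B * \<bar>t\<bar>"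
    by eventually_elim
      (auto elim!: order_trans intro!: mult_right_mono simp: B_def)
  have lim: "((\<lambda>t. 4 * M * B powr p * t powr (p - 2)) \<longlongrightarrow> 0) (at_right 0)"
  proof -
    have "((\<lambda>t::real. t powr (p - 2)) \<longlongrightarrow> 0) (at_right 0)"
      using p by (intro tendsto_zero_powrI[of _ _ "\<lambda>_. p - 2" "p - 2"])
        (auto intro!: tendsto_eq_intros simp: eventually_at_filter)
    from tendsto_mult_right_zero[OF this] show ?thesis by simp
  qed
  show ?thesis unfolding laplacian_le_def
  proof (intro allI impI)
    fix \<eta> :: real assume "\<eta> > 0"
    then have "\<forall>\<^sub>F t in at_right 0. 4 * M * B powr p * t powr (p - 2) < \<eta>"
      using lim by (intro order_tendstoD(2)[of _ 0]) auto
    moreover have "\<forall>\<^sub>F t in at_right (0::real). t > 0" by (simp add: eventually_at_right_less)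
    ultimately show "\<forall>\<^sub>F t in at_right 0. discrete_laplacian (\<lambda>x. F (f x)) z t \<le> (0 + \<eta>) * t\<^sup>2"
      using eventually_at_right_of_nhds_abs[OF ev]
    proof eventually_elim
      case (elim t)
      have bd: "F w \<le> M * B powr p * t powr p" if "cmod w \<le> B * t" for w
      proof -
        have "F w \<le> M * cmod w powr p" using F[of w] by simp
        also have "\<dots> \<le> M * (B * t) powr p"
          using that M p by (intro mult_left_mono powr_mono2) auto
        also have "\<dots> = M * B powr p * t powr p" using B elim by (simp add: powr_mult)
        finally show ?thesis .
      qed
      have "discrete_laplacian (\<lambda>x. F (f x)) z t \<le> 4 * (M * B powr p * t powr p)"
        using bd[of "f (z + of_real t)"] bd[of "f (z - of_real t)"] bd[of "f (z + \<i> * of_real t)"]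
          bd[of "f (z - \<i> * of_real t)"] elim by (simp add: discrete_laplacian_def f(4) F0)
      also have "\<dots> = (4 * M * B powr p * t powr (p - 2)) * t\<^sup>2"
        using elim by (simp add: powr_diff powr_numeral)
      also have "\<dots> \<le> \<eta> * t\<^sup>2" using elim by (intro mult_right_mono) auto
      finally show ?case by simp
    qed
  qed
qed

lemma barrier_laplacian_le:
  assumes p: "p > 2" and K: "K \<ge> 1" and f: "harmonic_quasiregular K f" and z: "z \<in> ball 0 1" "f z \<noteq> 0"
  shows "laplacian_le (\<lambda>x. barrier p (f x)) z
     (p * (p - 1) * (cone_coeff p + 1) * (K\<^sup>2 - 1) * cmod (f z) powr (p - 2) * ((Re (dx f z))\<^sup>2 + (Re (dy f z))\<^sup>2))"
proof -
  define X Y w where "X = dx f z" and "Y = dy f z" and "w = f z"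
  define g h where "g = (Re X)\<^sup>2 + (Re Y)\<^sup>2" and "h = (Im X)\<^sup>2 + (Im Y)\<^sup>2"
  have harm: "harmonic_on (ball 0 1) f" using f by (simp add: harmonic_quasiregular_def)
  note H = hessian_at_laplacian_le[OF harm open_ball z(1), folded X_def Y_def w_def]
  have qr: "h \<le> K\<^sup>2 * g" "cmod (X\<^sup>2 + Y\<^sup>2) \<le> (K\<^sup>2 - 1) * g"
    using quasiregular_gradient_bounds[OF K f z(1)] by (auto simp: g_def h_def X_def Y_def)
  have g: "g \<ge> 0" by (simp add: g_def)
  have b: "cone_coeff p > 0" by (rule cone_coeff_pos[OF p])
  have K1: "K\<^sup>2 - 1 \<ge> 0" using K by simp
  have pp: "p * (p - 1) > 0" using p by simp
  \<comment> \<open>The cone contributes at most \<open>cone_coeff p * Q\<close> and its complement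
    at most \<open>Q\<close>; the factor \<open>cone_coeff p + 1\<close> covers both.\<close>
  define Q where "Q = p * (p - 1) * (K\<^sup>2 - 1) * cmod w powr (p - 2) * g"
  have Q: "Q \<ge> 0" unfolding Q_def using p K1 g by (intro mult_nonneg_nonneg) auto
  have "continuous_on (ball 0 1) f"
    using harm by (intro C1_on_imp_continuous_on) (auto simp: harmonic_on_def)
  then have "isCont f z" using z(1) continuous_on_eq_continuous_at by blast
  then have "(f \<longlongrightarrow> w) (nhds z)"
    using tendsto_at_iff_tendsto_nhds[of f z] by (simp add: isCont_def w_def)
  note pull = eventually_compose_filterlim[OF _ this]
  have "laplacian_le (\<lambda>x. barrier p (f x)) z ((cone_coeff p + 1) * Q)"
  proof (cases "cone_slope p * \<bar>Re w\<bar> \<le> \<bar>Im w\<bar>")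
    case True
    define k where "k = - \<i> * of_real (sgn (Im w))"
    have "w \<noteq> 0" using z(2) by (simp add: w_def)
    note touch = barrier_touching_cone[OF p this True, folded k_def]
    have k1: "cmod k = 1"
      using arg_cong[OF touch(4), of cmod] by (simp add: norm_power power2_eq_1_iff) (smt (verit) norm_ge_zero)
    have "laplacian_le (\<lambda>x. cone_coeff p * Re ((k * f x) powr of_real p)) z
      (cone_coeff p * Re (of_real (p * (p - 1)) * (k * w) powr of_real (p - 2) * (k * X)\<^sup>2) +
       cone_coeff p * Re (of_real (p * (p - 1)) * (k * w) powr of_real (p - 2) * (k * Y)\<^sup>2))"
      by (rule H[OF hessian_at_cmult[OF hessian_at_Re_powr[OF touch(2)]]])
    moreover have "cone_coeff p * Re (of_real (p * (p - 1)) * (k * w) powr of_real (p - 2) * (k * X)\<^sup>2) +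
       cone_coeff p * Re (of_real (p * (p - 1)) * (k * w) powr of_real (p - 2) * (k * Y)\<^sup>2)
       \<le> (cone_coeff p + 1) * Q" (is "?l \<le> _")
    proof -
      define E where "E = of_real (p * (p - 1)) * (k * w) powr of_real (p - 2) * (k\<^sup>2 * (X\<^sup>2 + Y\<^sup>2))"
      have "?l = cone_coeff p * Re E"
        unfolding E_def by (simp only: power_mult_distrib distrib_left plus_complex.sel)
      also have "Re E \<le> cmod E" by (rule complex_Re_le_cmod)
      also have "cmod E = p * (p - 1) * cmod w powr (p - 2) * cmod (X\<^sup>2 + Y\<^sup>2)"
        using p by (simp add: E_def norm_mult norm_powr_real_powr' norm_power k1 abs_mult
            del: of_real_mult of_real_diff)
      also have "\<dots> \<le> p * (p - 1) * cmod w powr (p - 2) * ((K\<^sup>2 - 1) * g)"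
        using qr(2) pp by (intro mult_left_mono) auto
      also have "\<dots> = Q" by (simp add: Q_def)
      finally have "?l \<le> cone_coeff p * Q" using b by simp
      then show ?thesis using Q by (simp add: algebra_simps)
    qed
    ultimately have "laplacian_le (\<lambda>x. cone_coeff p * Re ((k * f x) powr of_real p)) z ((cone_coeff p + 1) * Q)"
      by (rule laplacian_le_mono)
    then show ?thesis
      by (rule laplacian_le_touching[OF _ pull[OF touch(1)]]) (use touch(3) in \<open>simp add: w_def\<close>)
  next
    case False
    define c where "c = cone_slope p"
    have c: "c \<ge> 1" using cone_slope_ge_1[OF p] by (simp add: c_def)
    have out: "\<bar>Im w\<bar> < c * \<bar>Re w\<bar>" using False by (simp add: c_def)
    have "laplacian_le (\<lambda>x. \<bar>Im (f x)\<bar> powr p + - (c powr p) * \<bar>Re (f x)\<bar> powr p) z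
       ((p * (p - 1) * \<bar>Im w\<bar> powr (p - 2) * (Im X)\<^sup>2 + - (c powr p) * (p * (p - 1) * \<bar>Re w\<bar> powr (p - 2) * (Re X)\<^sup>2))
      + (p * (p - 1) * \<bar>Im w\<bar> powr (p - 2) * (Im Y)\<^sup>2 + - (c powr p) * (p * (p - 1) * \<bar>Re w\<bar> powr (p - 2) * (Re Y)\<^sup>2)))"
      by (rule H[OF hessian_at_add[OF hessian_at_abs_powr[OF bounded_linear_Im p]
            hessian_at_cmult[OF hessian_at_abs_powr[OF bounded_linear_Re p]]]])
    moreover have "(p * (p - 1) * \<bar>Im w\<bar> powr (p - 2) * (Im X)\<^sup>2 + - (c powr p) * (p * (p - 1) * \<bar>Re w\<bar> powr (p - 2) * (Re X)\<^sup>2))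
      + (p * (p - 1) * \<bar>Im w\<bar> powr (p - 2) * (Im Y)\<^sup>2 + - (c powr p) * (p * (p - 1) * \<bar>Re w\<bar> powr (p - 2) * (Re Y)\<^sup>2))
      \<le> (cone_coeff p + 1) * Q" (is "?l \<le> _")
    proof -
      \<comment> \<open>Outside the cone, and since c \<ge> 1, the negative Re term outweighs
        \<bar>Im w\<bar> powr (p - 2) * g. Against h \<le> K^2 * g this leaves only the excess (K^2
        - 1) * g.\<close>
      have "\<bar>Im w\<bar> powr (p - 2) \<le> (c * \<bar>Re w\<bar>) powr (p - 2)"
        using out p by (intro powr_mono2) auto
      also have "\<dots> = c powr (p - 2) * \<bar>Re w\<bar> powr (p - 2)" using c by (simp add: powr_mult)
      also have "\<dots> \<le> c powr p * \<bar>Re w\<bar> powr (p - 2)"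
        using c by (intro mult_right_mono powr_mono) auto
      finally have cmp: "\<bar>Im w\<bar> powr (p - 2) \<le> c powr p * \<bar>Re w\<bar> powr (p - 2)" .
      have "?l = p * (p - 1) * (\<bar>Im w\<bar> powr (p - 2) * h - c powr p * \<bar>Re w\<bar> powr (p - 2) * g)"
        by (simp add: g_def h_def algebra_simps)
      also have "\<dots> \<le> p * (p - 1) * (\<bar>Im w\<bar> powr (p - 2) * (K\<^sup>2 * g) - \<bar>Im w\<bar> powr (p - 2) * g)"
        using qr(1) g cmp pp by (intro mult_left_mono diff_mono mult_right_mono) auto
      also have "\<dots> = p * (p - 1) * (K\<^sup>2 - 1) * \<bar>Im w\<bar> powr (p - 2) * g"
        by (simp add: algebra_simps)
      also have "\<dots> \<le> Q" unfolding Q_def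
        using pp K1 g p abs_Im_le_cmod by (intro mult_right_mono mult_left_mono powr_mono2) auto
      also have "\<dots> \<le> (cone_coeff p + 1) * Q" using b Q by (simp add: algebra_simps)
      finally show ?thesis .
    qed
    ultimately have lap: "laplacian_le (\<lambda>x. \<bar>Im (f x)\<bar> powr p + - (c powr p) * \<bar>Re (f x)\<bar> powr p) z
        ((cone_coeff p + 1) * Q)"
      by (rule laplacian_le_mono)
    have "\<forall>\<^sub>F x in nhds w. barrier p x \<le> \<bar>Im x\<bar> powr p + - (c powr p) * \<bar>Re x\<bar> powr p"
      using barrier_eventually_outside[of w p] out by (simp add: c_def eventually_mono)
    from laplacian_le_touching[OF lap pull[OF this]] show ?thesis
      using False by (simp add: barrier_def c_def w_def)
  qed
  moreover have "(cone_coeff p + 1) * Q = p * (p - 1) * (cone_coeff p + 1) * (K\<^sup>2 - 1) * cmod (f z) powr (p - 2) * ((Re (dx f z))\<^sup>2 + (Re (dy f z))\<^sup>2)"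
    by (simp add: Q_def g_def w_def X_def Y_def)
  ultimately show ?thesis by simp
qed

text \<open>In the cone the barrier is harmonic with a Hessian that is not definite, so its composition with
  a quasiregular map has a Laplacian of size \<open>K\<^sup>2 - 1\<close>. The convex function subtracted here absorbs it.\<close>

lemma perturbed_barrier_laplacian_le:
  assumes p: "p > 2" and K: "K \<ge> 1" and f: "harmonic_quasiregular K f" and z: "z \<in> ball 0 1"
    and L: "L \<ge> 1" and \<epsilon>: "\<epsilon> \<ge> 0" "(p - 1) * (cone_coeff p + 1) * (K\<^sup>2 - 1) \<le> \<epsilon> * L"
  shows "laplacian_le (\<lambda>x. barrier p (f x) - \<epsilon> * ((Im (f x))\<^sup>2 + L * (Re (f x))\<^sup>2) powr (p / 2)) z 0"
proof -
  have harm: "harmonic_on (ball 0 1) f" using f by (simp add: harmonic_quasiregular_def)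
  define N where "N w = (Im w)\<^sup>2 + L * (Re w)\<^sup>2" for w
  show ?thesis
  proof (cases "f z = 0")
    case True
    have "\<bar>barrier p w - \<epsilon> * N w powr (p / 2)\<bar> \<le>
       (cone_coeff p + 1 + cone_slope p powr p + \<epsilon> * L powr (p / 2)) * cmod w powr p" for w
    proof -
      have "N w \<le> L * (cmod w)\<^sup>2"
        using L mult_right_mono[of 1 L "(Im w)\<^sup>2"] by (simp add: N_def cmod_power2 algebra_simps)
      then have "N w powr (p / 2) \<le> (L * (cmod w)\<^sup>2) powr (p / 2)"
        using p L by (intro powr_mono2) (auto simp: N_def)
      also have "\<dots> = L powr (p / 2) * cmod w powr p"
        using L by (cases "w = 0") (auto simp: powr_mult powr_powr powr_numeral[symmetric] simp del: powr_numeral)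
      finally have "\<epsilon> * N w powr (p / 2) \<le> \<epsilon> * (L powr (p / 2) * cmod w powr p)"
        using \<epsilon>(1) by (rule mult_left_mono)
      moreover have "0 \<le> \<epsilon> * N w powr (p / 2)" using \<epsilon>(1) by simp
      ultimately show ?thesis using barrier_abs_le[OF p, of w] by (simp add: algebra_simps)
    qed
    from laplacian_le_at_zero[OF harm open_ball z True p this] show ?thesis by (simp add: N_def)
  next
    case False
    define X Y w where "X = dx f z" and "Y = dy f z" and "w = f z"
    define g where "g = (Re X)\<^sup>2 + (Re Y)\<^sup>2"
    obtain q where q: "hessian_at (\<lambda>w. N w powr (p / 2)) w q" "\<And>a. p * N w powr (p / 2 - 1) * N a \<le> q a"
      using hessian_at_quadratic_powr[of p L w] p L False unfolding N_def w_def by auto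
    have "laplacian_le (\<lambda>x. - \<epsilon> * N (f x) powr (p / 2)) z (- \<epsilon> * q X + - \<epsilon> * q Y)"
      using hessian_at_laplacian_le[OF harm open_ball z] hessian_at_cmult[OF q(1), of "- \<epsilon>"]
      unfolding X_def Y_def w_def by blast
    moreover have "- \<epsilon> * q X + - \<epsilon> * q Y \<le> - (p * (p - 1) * (cone_coeff p + 1) * (K\<^sup>2 - 1) * cmod w powr (p - 2) * g)"
    proof -
      have "cmod w powr (p - 2) = ((cmod w)\<^sup>2) powr (p / 2 - 1)"
        using False by (simp add: w_def powr_powr powr_numeral[symmetric] algebra_simps del: powr_numeral)
      also have "\<dots> \<le> N w powr (p / 2 - 1)"
        using p L mult_right_mono[of 1 L "(Re w)\<^sup>2"] by (intro powr_mono2) (auto simp: cmod_power2 N_def)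
      finally have r: "cmod w powr (p - 2) \<le> N w powr (p / 2 - 1)" .
      have "p * (p - 1) * (cone_coeff p + 1) * (K\<^sup>2 - 1) * cmod w powr (p - 2) * g
          = ((p - 1) * (cone_coeff p + 1) * (K\<^sup>2 - 1)) * (p * cmod w powr (p - 2) * g)"
        by (simp add: algebra_simps)
      also have "\<dots> \<le> (\<epsilon> * L) * (p * cmod w powr (p - 2) * g)"
        using \<epsilon>(2) p by (intro mult_right_mono mult_nonneg_nonneg) (auto simp: g_def)
      also have "\<dots> = \<epsilon> * (p * cmod w powr (p - 2) * (L * g))" by (simp add: algebra_simps)
      \<comment> \<open>N X + N Y is the squared gradient of Im f plus L * g. Discarding the former
        leaves L * g, which is why only the product \<epsilon> * L has to be large.\<close>
      also have "\<dots> \<le> \<epsilon> * (p * N w powr (p / 2 - 1) * (N X + N Y))"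
        using \<epsilon>(1) p r L by (intro mult_left_mono mult_mono) (auto simp: g_def N_def algebra_simps)
      also have "\<dots> \<le> \<epsilon> * (q X + q Y)"
        using q(2)[of X] q(2)[of Y] \<epsilon>(1) by (intro mult_left_mono) (auto simp: algebra_simps)
      finally show ?thesis by (simp add: algebra_simps)
    qed
    ultimately have "laplacian_le (\<lambda>x. - \<epsilon> * N (f x) powr (p / 2)) z
       (- (p * (p - 1) * (cone_coeff p + 1) * (K\<^sup>2 - 1) * cmod w powr (p - 2) * g))"
      by (rule laplacian_le_mono)
    from laplacian_le_add[OF barrier_laplacian_le[OF p K f z False] this] show ?thesis
      by (simp add: X_def Y_def w_def g_def N_def)
  qed
qed

subsection \<open>Integral means\<close>

text \<open>Convexity of the q-th power at x + y = lam * (x / lam) + (1 - lam) * (y / (1 - lam)).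
  Equality holds for lam = x / (x + y), so a suitable fixed lam reproduces Minkowski's inequality
  after integration; lam = 1/2 gives the factor 2 powr (q - 1).\<close>

lemma powr_sum_le:
  fixes x y q lam :: real
  assumes "x \<ge> 0" "y \<ge> 0" "q \<ge> 1" "0 < lam" "lam < 1"
  shows "(x + y) powr q \<le> lam powr (1 - q) * x powr q + (1 - lam) powr (1 - q) * y powr q"
proof -
  have one: "1 \<le> \<mu> powr (1 - q)" if "0 < \<mu>" "\<mu> < 1" for \<mu> :: real
    using powr_mono'[of "1 - q" 0 \<mu>] that assms(3) by simp
  consider "x = 0" | "y = 0" | "x > 0" "y > 0" using assms by linarith
  then show ?thesis
  proof cases
    case 1
    then show ?thesis using mult_right_mono[OF one[of "1 - lam"], of "y powr q"] assms by simp
  next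
    case 2
    then show ?thesis using mult_right_mono[OF one[of lam], of "x powr q"] assms by simp
  next
    case 3
    have resc: "\<mu> * (t / \<mu>) powr q = \<mu> powr (1 - q) * t powr q" if "0 < \<mu>" "t > 0" for \<mu> t :: real
      using that by (simp add: powr_divide powr_diff)
    have "((1 - lam) *\<^sub>R (y / (1 - lam)) + lam *\<^sub>R (x / lam)) powr q
        \<le> (1 - lam) * (y / (1 - lam)) powr q + lam * (x / lam) powr q"
      using 3 assms by (intro convex_onD[OF powr_convex[OF assms(3)]]) auto
    moreover have "(1 - lam) *\<^sub>R (y / (1 - lam)) + lam *\<^sub>R (x / lam) = x + y"
      using assms by simp
    ultimately show ?thesis using resc[of lam x] resc[of "1 - lam" y] 3 assms by (simp add: add.commute)
  qed
qed

lemma square_powr_half: "(x\<^sup>2) powr (p / 2) = \<bar>x\<bar> powr p" for x p :: real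
proof -
  have "x\<^sup>2 = \<bar>x\<bar> powr 2" by simp
  then show ?thesis by (simp only: powr_powr) simp
qed

lemma integral_circle_le:
  fixes f :: "complex \<Rightarrow> complex"
  assumes f: "continuous_on (ball 0 1) f" and r: "0 \<le> r" "r < 1"
    and h: "continuous_on UNIV h1" "continuous_on UNIV h2" "continuous_on UNIV h3"
    and le: "\<And>w. h1 w \<le> A * h2 w + B * h3 w"
  shows "integral {0..2*pi} (\<lambda>\<theta>. h1 (f (of_real r * cis \<theta>)) :: real)
     \<le> A * integral {0..2*pi} (\<lambda>\<theta>. h2 (f (of_real r * cis \<theta>))) + B * integral {0..2*pi} (\<lambda>\<theta>. h3 (f (of_real r * cis \<theta>)))"
proof -
  have fc: "continuous_on {0..2*pi} (\<lambda>\<theta>. f (of_real r * cis \<theta>))"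
    by (rule continuous_on_compose2[OF f]) (use r in \<open>auto intro!: continuous_intros simp: norm_mult\<close>)
  have i: "(\<lambda>\<theta>. h (f (of_real r * cis \<theta>))) integrable_on {0..2*pi}"
    if "continuous_on UNIV h" for h :: "complex \<Rightarrow> real"
    by (intro integrable_continuous_real continuous_on_compose2[OF that fc]) auto
  show ?thesis
    by (rule has_integral_le[OF integrable_integral[OF i[OF h(1)]]
        has_integral_add[OF has_integral_mult_right[OF integrable_integral[OF i[OF h(2)]]]
          has_integral_mult_right[OF integrable_integral[OF i[OF h(3)]]]]]) (rule le)
qed

lemma circle_integral_nonpos:
  fixes f :: "complex \<Rightarrow> complex"
  assumes f: "continuous_on (ball 0 1) f" and r: "0 \<le> r" "r < 1"
    and F: "continuous_on UNIV F" and lap: "\<And>z. z \<in> ball 0 1 \<Longrightarrow> laplacian_le (\<lambda>x. F (f x)) z 0"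
    and 0: "F (f 0) \<le> 0"
  shows "integral {0..2*pi} (\<lambda>\<theta>. F (f (of_real r * cis \<theta>))) \<le> 0"
proof -
  have "continuous_on (cball 0 r) f"
    by (rule continuous_on_subset[OF f]) (use r in auto)
  then have "continuous_on (cball 0 r) (\<lambda>z. F (f z))"
    by (intro continuous_on_compose2[OF F]) auto
  then have "integral {0..2*pi} (\<lambda>\<theta>. F (f (of_real r * cis \<theta>))) \<le> 2 * pi * F (f 0)"
    using r lap by (intro circle_mean_le_centre) auto
  also have "\<dots> \<le> 0" using 0 by (simp add: mult_le_0_iff)
  finally show ?thesis .
qed

lemma continuous_on_abs_powr:
  assumes "continuous_on S h" "p > 0"
  shows "continuous_on S (\<lambda>x. \<bar>h x :: real\<bar> powr p)"
  using assms by (intro continuous_on_powr' continuous_intros) auto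

lemma harmonic_quasiregular_continuous:
  "harmonic_quasiregular K f \<Longrightarrow> continuous_on (ball 0 1) f"
  by (intro C1_on_imp_continuous_on) (auto simp: harmonic_quasiregular_def harmonic_on_def)

text \<open>The correction is split by \<open>powr_sum_le\<close> with lam = 1/2. Its Im part is
  moved to the left, at the price of the divisor 1 - d, and its Re part enlarges the constant. The
  mean of F is nonpositive and drops out.\<close>

lemma quasiregular_Riesz_bound:
  assumes p: "p > 2" and K: "K \<ge> 1" and f: "harmonic_quasiregular K f"
    and f0: "\<bar>Im (f 0)\<bar> \<le> cone_slope p * \<bar>Re (f 0)\<bar>" and r: "0 \<le> r" "r < 1"
    and L: "L \<ge> 1" and \<epsilon>: "\<epsilon> \<ge> 0" "(p - 1) * (cone_coeff p + 1) * (K\<^sup>2 - 1) \<le> \<epsilon> * L"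
    and e: "\<epsilon> * 2 powr (p / 2 - 1) < 1"
  shows "integral {0..2*pi} (\<lambda>\<theta>. \<bar>Im (f (of_real r * cis \<theta>))\<bar> powr p)
     \<le> (cone_slope p powr p + \<epsilon> * 2 powr (p / 2 - 1) * L powr (p / 2)) / (1 - \<epsilon> * 2 powr (p / 2 - 1))
       * integral {0..2*pi} (\<lambda>\<theta>. \<bar>Re (f (of_real r * cis \<theta>))\<bar> powr p)"
proof -
  define F where "F w = barrier p w - \<epsilon> * ((Im w)\<^sup>2 + L * (Re w)\<^sup>2) powr (p / 2)" for w
  define d where "d = \<epsilon> * 2 powr (p / 2 - 1)"
  define c where "c = cone_slope p powr p"
  have fc: "continuous_on (ball 0 1) f" using f by (rule harmonic_quasiregular_continuous)
  have Fc: "continuous_on UNIV F"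
    unfolding F_def using p L
    by (intro continuous_intros continuous_on_barrier continuous_on_powr') auto
  have F0: "F (f 0) \<le> 0"
    using barrier_nonpos[OF p f0] \<epsilon>(1) by (simp add: F_def) (smt (verit) mult_nonneg_nonneg powr_ge_zero)
  have lap: "laplacian_le (\<lambda>x. F (f x)) z 0" if "z \<in> ball 0 1" for z
    unfolding F_def by (rule perturbed_barrier_laplacian_le[OF p K f that L \<epsilon>])
  have int: "integral {0..2*pi} (\<lambda>\<theta>. F (f (of_real r * cis \<theta>))) \<le> 0"
    by (rule circle_integral_nonpos[OF fc r Fc lap F0])
  have d: "d < 1" using e by (simp add: d_def)
  have pt: "\<bar>Im w\<bar> powr p \<le> (c + d * L powr (p / 2)) / (1 - d) * \<bar>Re w\<bar> powr p + 1 / (1 - d) * F w" for w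
  proof -
    have "((Im w)\<^sup>2 + L * (Re w)\<^sup>2) powr (p / 2)
       \<le> (1/2) powr (1 - p / 2) * ((Im w)\<^sup>2) powr (p / 2) + (1 - 1/2) powr (1 - p / 2) * (L * (Re w)\<^sup>2) powr (p / 2)"
      using p L by (intro powr_sum_le) auto
    also have "\<dots> = 2 powr (p / 2 - 1) * (\<bar>Im w\<bar> powr p + L powr (p / 2) * \<bar>Re w\<bar> powr p)"
    proof -
      have "(1/2) powr (1 - p / 2) = 2 powr (p / 2 - 1)"
        using powr_minus_divide[of 2 "1 - p / 2"] by (simp add: powr_divide)
      then show ?thesis
        using L by (simp add: powr_mult square_powr_half algebra_simps)
    qed
    finally have "\<epsilon> * ((Im w)\<^sup>2 + L * (Re w)\<^sup>2) powr (p / 2)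
       \<le> \<epsilon> * (2 powr (p / 2 - 1) * (\<bar>Im w\<bar> powr p + L powr (p / 2) * \<bar>Re w\<bar> powr p))"
      using \<epsilon>(1) by (rule mult_left_mono)
    then have "(1 - d) * \<bar>Im w\<bar> powr p \<le> (c + d * L powr (p / 2)) * \<bar>Re w\<bar> powr p + F w"
      using barrier_ge[OF p, of w] by (simp add: F_def c_def d_def algebra_simps)
    then have "\<bar>Im w\<bar> powr p \<le> ((c + d * L powr (p / 2)) * \<bar>Re w\<bar> powr p + F w) / (1 - d)"
      using d by (simp add: le_divide_eq mult.commute)
    also have "\<dots> = (c + d * L powr (p / 2)) / (1 - d) * \<bar>Re w\<bar> powr p + 1 / (1 - d) * F w"
      by (subst add_divide_distrib) simp
    finally show ?thesis .
  qed
  have "integral {0..2*pi} (\<lambda>\<theta>. \<bar>Im (f (of_real r * cis \<theta>))\<bar> powr p)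
    \<le> (c + d * L powr (p / 2)) / (1 - d) * integral {0..2*pi} (\<lambda>\<theta>. \<bar>Re (f (of_real r * cis \<theta>))\<bar> powr p)
      + 1 / (1 - d) * integral {0..2*pi} (\<lambda>\<theta>. F (f (of_real r * cis \<theta>)))"
    using p by (intro integral_circle_le[OF fc r _ _ Fc pt] continuous_on_abs_powr continuous_intros) auto
  also have "1 / (1 - d) * integral {0..2*pi} (\<lambda>\<theta>. F (f (of_real r * cis \<theta>))) \<le> 0"
    using int d by (simp add: divide_le_0_iff)
  finally show ?thesis by (simp add: c_def d_def)
qed

text \<open>For p = 2 the quadratic (Im w)^2 - K^2 * (Re w)^2 is its own barrier: along f its
  Laplacian is nonpositive by the first gradient bound.\<close>

lemma quasiregular_Riesz_bound_2:
  assumes K: "K \<ge> 1" and f: "harmonic_quasiregular K f"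
    and f0: "\<bar>Im (f 0)\<bar> \<le> \<bar>Re (f 0)\<bar>" and r: "0 \<le> r" "r < 1"
  shows "integral {0..2*pi} (\<lambda>\<theta>. \<bar>Im (f (of_real r * cis \<theta>))\<bar> powr 2)
     \<le> K\<^sup>2 * integral {0..2*pi} (\<lambda>\<theta>. \<bar>Re (f (of_real r * cis \<theta>))\<bar> powr 2)"
proof -
  define F where "F w = (Im w)\<^sup>2 + - (K\<^sup>2) * (Re w)\<^sup>2" for w
  have fc: "continuous_on (ball 0 1) f" using f by (rule harmonic_quasiregular_continuous)
  have harm: "harmonic_on (ball 0 1) f" using f by (simp add: harmonic_quasiregular_def)
  have Fc: "continuous_on UNIV F" unfolding F_def by (intro continuous_intros)
  have "(Im (f 0))\<^sup>2 \<le> (Re (f 0))\<^sup>2" using f0 by (simp add: abs_le_square_iff)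
  also have "\<dots> \<le> K\<^sup>2 * (Re (f 0))\<^sup>2" using K mult_right_mono[of 1 "K\<^sup>2"] by simp
  finally have F0: "F (f 0) \<le> 0" by (simp add: F_def)
  have lap: "laplacian_le (\<lambda>x. F (f x)) z 0" if z: "z \<in> ball 0 1" for z
  proof (rule laplacian_le_mono)
    show "laplacian_le (\<lambda>x. F (f x)) z
       ((2 * (Im (dx f z))\<^sup>2 + - (K\<^sup>2) * (2 * (Re (dx f z))\<^sup>2)) + (2 * (Im (dy f z))\<^sup>2 + - (K\<^sup>2) * (2 * (Re (dy f z))\<^sup>2)))"
      unfolding F_def
      by (rule hessian_at_laplacian_le[OF harm open_ball z hessian_at_add[OF hessian_at_square[OF bounded_linear_Im]
            hessian_at_cmult[OF hessian_at_square[OF bounded_linear_Re]]]])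
    show "(2 * (Im (dx f z))\<^sup>2 + - (K\<^sup>2) * (2 * (Re (dx f z))\<^sup>2)) + (2 * (Im (dy f z))\<^sup>2 + - (K\<^sup>2) * (2 * (Re (dy f z))\<^sup>2)) \<le> 0"
      using quasiregular_gradient_bounds(1)[OF K f z] by (simp add: algebra_simps)
  qed
  have int: "integral {0..2*pi} (\<lambda>\<theta>. F (f (of_real r * cis \<theta>))) \<le> 0"
    by (rule circle_integral_nonpos[OF fc r Fc lap F0])
  have "\<bar>Im w\<bar> powr 2 \<le> K\<^sup>2 * \<bar>Re w\<bar> powr 2 + 1 * F w" for w by (simp add: F_def)
  then have "integral {0..2*pi} (\<lambda>\<theta>. \<bar>Im (f (of_real r * cis \<theta>))\<bar> powr 2)
    \<le> K\<^sup>2 * integral {0..2*pi} (\<lambda>\<theta>. \<bar>Re (f (of_real r * cis \<theta>))\<bar> powr 2)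
      + 1 * integral {0..2*pi} (\<lambda>\<theta>. F (f (of_real r * cis \<theta>)))"
    by (intro integral_circle_le[OF fc r _ _ Fc] continuous_on_abs_powr continuous_intros) auto
  then show ?thesis using int by simp
qed

lemma quasiregular_Riesz_constant:
  assumes p: "p \<ge> 2"
  shows "\<exists>A :: real \<Rightarrow> real. (A \<longlongrightarrow> cot (pi / (2 * p)) powr p) (at_right 1) \<and> (\<forall>K\<ge>1. A K > 0) \<and>
    (\<forall>K\<ge>1. \<forall>f. harmonic_quasiregular K f \<and> \<bar>Im (f 0)\<bar> \<le> cot (pi / (2 * p)) * \<bar>Re (f 0)\<bar> \<longrightarrow>
      (\<forall>r. 0 \<le> r \<and> r < 1 \<longrightarrow>
       integral {0..2*pi} (\<lambda>\<theta>. \<bar>Im (f (of_real r * cis \<theta>))\<bar> powr p)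
         \<le> A K * integral {0..2*pi} (\<lambda>\<theta>. \<bar>Re (f (of_real r * cis \<theta>))\<bar> powr p)))"
proof (cases "p = 2")
  case True
  have "cot (pi / (2 * p)) = 1" by (simp add: True cot_def sin_45 cos_45)
  moreover have "((\<lambda>K::real. K\<^sup>2) \<longlongrightarrow> 1) (at_right 1)" by (auto intro!: tendsto_eq_intros)
  ultimately show ?thesis unfolding True
    using quasiregular_Riesz_bound_2 by (intro exI[of _ "\<lambda>K. K\<^sup>2"]) (auto simp: True)
next
  case False
  then have p: "p > 2" using assms by simp
  define \<tau> where "\<tau> K = (p - 1) * (cone_coeff p + 1) * (K\<^sup>2 - 1)" for K :: real
  \<comment> \<open>The choices give \<epsilon> K * L K = \<tau> K exactly and \<epsilon> K \<le>
    \<delta> for every K, with \<delta> such that \<delta> * 2 powr (p / 2 - 1) = 1/2. As \<tau> K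
    tends to 0, so does \<epsilon> K, and L K tends to 1.\<close>
  define \<delta> where "\<delta> = (2::real) powr (- p / 2)"
  define L where "L K = 1 + \<tau> K / \<delta>" for K
  define \<epsilon> where "\<epsilon> K = \<tau> K / L K" for K
  define A where "A K = (cone_slope p powr p + \<epsilon> K * 2 powr (p / 2 - 1) * L K powr (p / 2)) / (1 - \<epsilon> K * 2 powr (p / 2 - 1))" for K
  have \<delta>: "\<delta> > 0" by (simp add: \<delta>_def)
  have \<tau>: "\<tau> K \<ge> 0" if "K \<ge> 1" for K
    unfolding \<tau>_def using that p cone_coeff_pos[OF p] by (intro mult_nonneg_nonneg) auto
  have L: "L K \<ge> 1" if "K \<ge> 1" for K using \<tau>[OF that] \<delta> by (simp add: L_def)
  have \<epsilon>: "\<epsilon> K \<ge> 0" "\<epsilon> K * L K = \<tau> K" if "K \<ge> 1" for K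
    using \<tau>[OF that] L[OF that] by (auto simp: \<epsilon>_def)
  have e: "\<epsilon> K * 2 powr (p / 2 - 1) < 1" if "K \<ge> 1" for K
  proof -
    have "\<epsilon> K \<le> \<delta>"
      using \<tau>[OF that] \<delta> L[OF that]
      by (simp add: \<epsilon>_def pos_divide_le_eq) (simp add: L_def algebra_simps)
    then have "\<epsilon> K * 2 powr (p / 2 - 1) \<le> \<delta> * 2 powr (p / 2 - 1)" by (rule mult_right_mono) simp
    also have "\<dots> = 2 powr (- p / 2 + (p / 2 - 1))" unfolding \<delta>_def by (rule powr_add[symmetric])
    also have "\<dots> = 1 / 2" by (simp add: powr_minus_divide)
    finally show ?thesis by simp
  qed
  have slope: "cone_slope p powr p > 0" using cone_slope_ge_1[OF p] by simp
  have "(\<tau> \<longlongrightarrow> 0) (at_right 1)" unfolding \<tau>_def by (auto intro!: tendsto_eq_intros)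
  then have limL: "(L \<longlongrightarrow> 1) (at_right 1)" unfolding L_def using \<delta> by (auto intro!: tendsto_eq_intros)
  then have lim\<epsilon>: "(\<epsilon> \<longlongrightarrow> 0) (at_right 1)"
    unfolding \<epsilon>_def using \<open>(\<tau> \<longlongrightarrow> 0) (at_right 1)\<close> by (auto intro!: tendsto_eq_intros)
  have "(A \<longlongrightarrow> (cone_slope p powr p + 0 * 2 powr (p / 2 - 1) * 1 powr (p / 2)) / (1 - 0 * 2 powr (p / 2 - 1))) (at_right 1)"
    unfolding A_def by (intro tendsto_intros limL lim\<epsilon>) auto
  then have limA: "(A \<longlongrightarrow> cot (pi / (2 * p)) powr p) (at_right 1)" by (simp add: cone_slope_def)
  have posA: "A K > 0" if "K \<ge> 1" for K
    unfolding A_def using slope e[OF that] \<epsilon>(1)[OF that] by (intro divide_pos_pos add_pos_nonneg) auto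
  have "integral {0..2*pi} (\<lambda>\<theta>. \<bar>Im (f (of_real r * cis \<theta>))\<bar> powr p)
         \<le> A K * integral {0..2*pi} (\<lambda>\<theta>. \<bar>Re (f (of_real r * cis \<theta>))\<bar> powr p)"
    if "K \<ge> 1" "harmonic_quasiregular K f" "\<bar>Im (f 0)\<bar> \<le> cot (pi / (2 * p)) * \<bar>Re (f 0)\<bar>" "0 \<le> r" "r < 1" for K f r
    unfolding A_def using that L[of K] \<epsilon>[of K] e[of K]
    by (intro quasiregular_Riesz_bound[OF p]) (auto simp: cone_slope_def \<tau>_def)
  then show ?thesis using limA posA by blast
qed

section \<open>From integrals over circles to Hardy norms\<close>

lemma integral_norm_powr_nonneg: "0 \<le> integral S (\<lambda>x. norm (g x) powr p)"
  by (cases "(\<lambda>x. norm (g x) powr p) integrable_on S")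
    (auto intro!: integral_nonneg simp: not_integrable_integral)

lemma int_mean_mono:
  assumes p: "p > 0" and A: "A \<ge> 0"
    and le: "integral {0..2*pi} (\<lambda>\<theta>. norm (g (of_real r * cis \<theta>)) powr p)
      \<le> A * integral {0..2*pi} (\<lambda>\<theta>. norm (h (of_real r * cis \<theta>)) powr p)"
  shows "int_mean p r g \<le> A powr (1 / p) * int_mean p r h"
proof -
  define I J where "I = integral {0..2*pi} (\<lambda>\<theta>. norm (g (of_real r * cis \<theta>)) powr p)"
    and "J = integral {0..2*pi} (\<lambda>\<theta>. norm (h (of_real r * cis \<theta>)) powr p)"
  have nn: "I \<ge> 0" "J \<ge> 0" unfolding I_def J_def by (rule integral_norm_powr_nonneg)+
  have "(1 / (2 * pi) * I) powr (1 / p) \<le> (A * (1 / (2 * pi) * J)) powr (1 / p)"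
    using p nn le by (intro powr_mono2) (auto simp: I_def J_def divide_right_mono)
  also have "\<dots> = A powr (1 / p) * (1 / (2 * pi) * J) powr (1 / p)"
    using A nn by (subst powr_mult) auto
  finally show ?thesis by (simp add: int_mean_def I_def J_def)
qed

lemma hardy_norm_le:
  assumes "\<And>r. 0 \<le> r \<Longrightarrow> r < 1 \<Longrightarrow> int_mean p r g \<le> c * int_mean p r h" "c \<ge> 0"
  shows "hardy_norm p g \<le> ereal c * hardy_norm p h"
  unfolding hardy_norm_def[of p g]
proof (rule SUP_least)
  fix r :: real assume "r \<in> {0..<1}"
  then have "ereal (int_mean p r g) \<le> ereal c * ereal (int_mean p r h)" using assms(1) by simp
  also have "\<dots> \<le> ereal c * hardy_norm p h"
    unfolding hardy_norm_def using \<open>r \<in> {0..<1}\<close> assms(2) by (intro ereal_mult_left_mono SUP_upper) auto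
  finally show "ereal (int_mean p r g) \<le> ereal c * hardy_norm p h" .
qed

text \<open>The squares of Im f and Re f have L^q norms of ratio at most a = A powr (2 / p), where q
  = p / 2. The weight lam = 1 / (1 + a) is optimal for that ratio, so the triangle inequality comes
  out with its exact factor 1 + a.\<close>

lemma Minkowski_circle:
  fixes f :: "complex \<Rightarrow> complex"
  assumes p: "p \<ge> 2" and A: "A > 0" and f: "continuous_on (ball 0 1) f" and r: "0 \<le> r" "r < 1"
    and le: "integral {0..2*pi} (\<lambda>\<theta>. \<bar>Im (f (of_real r * cis \<theta>))\<bar> powr p)
         \<le> A * integral {0..2*pi} (\<lambda>\<theta>. \<bar>Re (f (of_real r * cis \<theta>))\<bar> powr p)"
  shows "integral {0..2*pi} (\<lambda>\<theta>. cmod (f (of_real r * cis \<theta>)) powr p)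
     \<le> (1 + A powr (2 / p)) powr (p / 2) * integral {0..2*pi} (\<lambda>\<theta>. \<bar>Re (f (of_real r * cis \<theta>))\<bar> powr p)"
proof -
  define a where "a = A powr (2 / p)"
  have a: "a > 0" using A by (simp add: a_def)
  have Aa: "A = a powr (p / 2)" using p A by (simp add: a_def powr_powr)
  define q where "q = p / 2"
  have pt: "cmod w powr p \<le> (1 / (1 + a)) powr (1 - q) * \<bar>Re w\<bar> powr p + (a / (1 + a)) powr (1 - q) * \<bar>Im w\<bar> powr p" for w
  proof -
    have sq: "(x\<^sup>2) powr q = \<bar>x\<bar> powr p" for x :: real
      by (simp add: q_def square_powr_half)
    have "1 - 1 / (1 + a) = a / (1 + a)" using a by (simp add: field_simps)
    then have "((Re w)\<^sup>2 + (Im w)\<^sup>2) powr q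
      \<le> (1 / (1 + a)) powr (1 - q) * ((Re w)\<^sup>2) powr q + (a / (1 + a)) powr (1 - q) * ((Im w)\<^sup>2) powr q"
      using powr_sum_le[of "(Re w)\<^sup>2" "(Im w)\<^sup>2" q "1 / (1 + a)"] a p by (simp add: q_def)
    moreover have "((Re w)\<^sup>2 + (Im w)\<^sup>2) powr q = cmod w powr p"
      using sq[of "cmod w"] by (simp add: cmod_power2)
    ultimately show ?thesis by (simp add: sq)
  qed
  define I J where "I = integral {0..2*pi} (\<lambda>\<theta>. \<bar>Re (f (of_real r * cis \<theta>))\<bar> powr p)"
    and "J = integral {0..2*pi} (\<lambda>\<theta>. \<bar>Im (f (of_real r * cis \<theta>))\<bar> powr p)"
  have "integral {0..2*pi} (\<lambda>\<theta>. cmod (f (of_real r * cis \<theta>)) powr p)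
     \<le> (1 / (1 + a)) powr (1 - q) * I + (a / (1 + a)) powr (1 - q) * J"
    unfolding I_def J_def using p
    by (intro integral_circle_le[OF f r _ _ _ pt] continuous_on_powr' continuous_intros) auto
  also have "\<dots> \<le> (1 / (1 + a)) powr (1 - q) * I + (a / (1 + a)) powr (1 - q) * (A * I)"
    using le unfolding I_def J_def by (intro add_left_mono mult_left_mono) auto
  also have "\<dots> = (1 + a) powr q * I"
  proof -
    have "(1 / (1 + a)) powr (1 - q) = (1 + a) powr q / (1 + a)"
      using a by (simp add: powr_divide powr_diff)
    moreover have "(a / (1 + a)) powr (1 - q) * A = a * ((1 + a) powr q / (1 + a))"
      using a by (simp add: powr_divide powr_diff Aa q_def)
    moreover have "(1 + a) powr q / (1 + a) + a * ((1 + a) powr q / (1 + a)) = (1 + a) powr q"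
    proof -
      have "x / (1 + a) + a * (x / (1 + a)) = (1 + a) * (x / (1 + a))" for x
        by (simp only: distrib_right mult_1)
      then show ?thesis using a by simp
    qed
    ultimately show ?thesis by (simp only: mult.assoc[symmetric] distrib_right[symmetric])
  qed
  finally show ?thesis by (simp add: a_def q_def I_def)
qed

subsection \<open>The condition at the origin\<close>

lemma sin_ge_sin_between:
  assumes "0 \<le> \<theta>" "\<theta> \<le> y" "y \<le> pi - \<theta>"
  shows "sin \<theta> \<le> sin y"
proof (cases "y \<le> pi / 2")
  case True
  then show ?thesis using assms by (intro sin_monotone_2pi_le) auto
next
  case False
  then have "sin \<theta> \<le> sin (pi - y)" using assms by (intro sin_monotone_2pi_le) auto
  then show ?thesis by simp
qed

text \<open>Used contrapositively with x = t - pi / 2, where \<bar>sin x\<bar> = \<bar>cos t\<bar>: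
  the hypothesis on the sine places w strictly inside the cone. The bound on \<bar>x\<bar> excludes
  its lower half, so \<bar>x\<bar> < pi / (2 * p) and \<bar>p * x\<bar> < pi / 2.\<close>

lemma cos_pos_of_sin_less:
  assumes p: "p \<ge> 2" and x: "\<bar>x\<bar> \<le> pi - pi / (2 * p)" "\<bar>sin x\<bar> < sin (pi / (2 * p))"
  shows "0 < cos (p * x)"
proof -
  have "\<bar>x\<bar> < pi / (2 * p)"
  proof (rule ccontr)
    assume "\<not> \<bar>x\<bar> < pi / (2 * p)"
    then have "sin (pi / (2 * p)) \<le> sin \<bar>x\<bar>"
      using p x by (intro sin_ge_sin_between) auto
    then show False using x(2) by (auto simp: abs_if split: if_splits)
  qed
  then have "p * \<bar>x\<bar> < pi / 2" using p by (simp add: field_simps)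
  then have "0 < cos (p * \<bar>x\<bar>)" using p by (intro cos_gt_zero_pi) (auto intro: less_le_trans[of _ 0])
  then show ?thesis by (auto simp: abs_if split: if_splits)
qed

text \<open>For even p both \<bar>sin x\<bar> and cos (p * x) have period pi, so x can be moved into
  [- pi / 2, pi / 2].\<close>

lemma cos_pos_of_sin_less_even:
  assumes p: "p \<ge> 2" "p = of_int m" "even m" and x: "\<bar>sin x\<bar> < sin (pi / (2 * p))"
  shows "0 < cos (p * x)"
proof -
  define n y where "n = round (x / pi)" and "y = x - of_int n * pi"
  obtain k where m: "m = 2 * k" using p(3) by (rule evenE)
  have "\<bar>x / pi - of_int n\<bar> \<le> 1 / 2"
    unfolding n_def using of_int_round_abs_le[of "x / pi"] by (simp add: abs_minus_commute)
  then have "\<bar>x / pi - of_int n\<bar> * pi \<le> 1 / 2 * pi" by (intro mult_right_mono) auto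
  moreover have "\<bar>x / pi - of_int n\<bar> * pi = \<bar>y\<bar>"
    using abs_mult[of "x / pi - of_int n" pi] by (simp add: y_def left_diff_distrib)
  ultimately have y: "\<bar>y\<bar> \<le> pi / 2" by simp
  have x_eq: "x = y + of_int n * pi" by (simp add: y_def)
  have sc: "sin (of_int n * pi) = 0" "\<bar>cos (of_int n * pi)\<bar> = 1"
  proof -
    show s: "sin (of_int n * pi) = 0" by (simp add: sin_zero_iff_int2)
    show "\<bar>cos (of_int n * pi)\<bar> = 1"
      using sin_cos_squared_add[of "of_int n * pi"] s by (simp add: power2_eq_1_iff) auto
  qed
  have "\<bar>sin y\<bar> = \<bar>sin x\<bar>" unfolding x_eq sin_add by (simp add: sc abs_mult)
  moreover have "pi / (2 * p) \<le> pi / 2" using p(1) by (simp add: field_simps)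
  ultimately have "0 < cos (p * y)"
    using x y p(1) by (intro cos_pos_of_sin_less) auto
  also have "p * x = p * y + 2 * pi * of_int (k * n)"
    by (simp add: x_eq p(2) m algebra_simps)
  then have "cos (p * y) = cos (p * x)" by (simp add: cos_add del: of_int_mult)
  finally show ?thesis .
qed

text \<open>\<bar>cos t\<bar> \<ge> sin \<theta> forces \<bar>sin t\<bar> \<le> cos \<theta>;
  multiplying the two gives the slope condition.\<close>

lemma Im_le_cot_Re:
  assumes p: "p \<ge> 2" and w: "is_Arg w t" and s: "sin (pi / (2 * p)) \<le> \<bar>sin (t - pi / 2)\<bar>"
  shows "\<bar>Im w\<bar> \<le> cot (pi / (2 * p)) * \<bar>Re w\<bar>"
proof -
  define \<theta> where "\<theta> = pi / (2 * p)"
  have \<theta>: "0 < \<theta>" "\<theta> < pi / 2" using p by (auto simp: \<theta>_def field_simps)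
  then have pos: "0 < sin \<theta>" "0 < cos \<theta>" by (auto intro!: sin_gt_zero cos_gt_zero)
  have w': "Re w = cmod w * cos t" "Im w = cmod w * sin t"
    using w unfolding is_Arg_def cis_conv_exp[symmetric]
    by (metis Re_complex_of_real cis.simps rcis_def Re_rcis, metis rcis_def Im_rcis)
  have ct: "sin \<theta> \<le> \<bar>cos t\<bar>" using s by (simp add: sin_diff \<theta>_def)
  have "(sin \<theta>)\<^sup>2 \<le> (cos t)\<^sup>2" using power_mono[OF ct, of 2] pos by simp
  then have "(sin t)\<^sup>2 \<le> (cos \<theta>)\<^sup>2" by (simp add: sin_squared_eq)
  then have st: "\<bar>sin t\<bar> \<le> cos \<theta>" using pos by (simp add: abs_le_square_iff[symmetric])
  have "\<bar>sin t\<bar> * sin \<theta> \<le> cos \<theta> * \<bar>cos t\<bar>" using st ct pos by (intro mult_mono) auto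
  then have "\<bar>sin t\<bar> \<le> cot \<theta> * \<bar>cos t\<bar>" using pos by (simp add: cot_def field_simps)
  then have "cmod w * \<bar>sin t\<bar> \<le> cmod w * (cot \<theta> * \<bar>cos t\<bar>)" by (rule mult_left_mono) simp
  then show ?thesis by (simp add: w' abs_mult \<theta>_def algebra_simps)
qed

lemma quasiregular_Riesz_hardy:
  assumes p: "p \<ge> 2"
  shows "\<exists>C c :: real \<Rightarrow> real.
    (C \<longlongrightarrow> 1 / sin (pi / (2 * p))) (at_right 1) \<and> (c \<longlongrightarrow> cot (pi / (2 * p))) (at_right 1) \<and>
    (\<forall>K\<ge>1. \<forall>f. harmonic_quasiregular K f \<and> \<bar>Im (f 0)\<bar> \<le> cot (pi / (2 * p)) * \<bar>Re (f 0)\<bar> \<longrightarrow>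
      hardy_norm p f \<le> ereal (C K) * hardy_norm p (\<lambda>z. Re (f z)) \<and>
      hardy_norm p (\<lambda>z. Im (f z)) \<le> ereal (c K) * hardy_norm p (\<lambda>z. Re (f z)))"
proof -
  define \<theta> where "\<theta> = pi / (2 * p)"
  have \<theta>: "0 < \<theta>" "\<theta> < pi / 2" using p by (auto simp: \<theta>_def field_simps)
  then have pos: "0 < sin \<theta>" "0 < cos \<theta>" by (auto intro!: sin_gt_zero cos_gt_zero)
  have cot: "cot \<theta> > 0" using pos by (simp add: cot_def)
  obtain A :: "real \<Rightarrow> real" where limA: "(A \<longlongrightarrow> cot \<theta> powr p) (at_right 1)"
    and A: "\<And>K. K \<ge> 1 \<Longrightarrow> A K > 0"
    and le: "\<And>K f r. K \<ge> 1 \<Longrightarrow> harmonic_quasiregular K f \<Longrightarrow> \<bar>Im (f 0)\<bar> \<le> cot \<theta> * \<bar>Re (f 0)\<bar> \<Longrightarrow>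
       0 \<le> r \<Longrightarrow> r < 1 \<Longrightarrow> integral {0..2*pi} (\<lambda>\<theta>. \<bar>Im (f (of_real r * cis \<theta>))\<bar> powr p)
         \<le> A K * integral {0..2*pi} (\<lambda>\<theta>. \<bar>Re (f (of_real r * cis \<theta>))\<bar> powr p)"
    using quasiregular_Riesz_constant[OF p] unfolding \<theta>_def by blast
  define c C where "c K = A K powr (1 / p)" and "C K = ((1 + A K powr (2 / p)) powr (p / 2)) powr (1 / p)" for K
  have limc: "(c \<longlongrightarrow> cot \<theta>) (at_right 1)"
  proof -
    have "(c \<longlongrightarrow> (cot \<theta> powr p) powr (1 / p)) (at_right 1)"
      unfolding c_def using cot by (intro tendsto_intros limA) auto
    then show ?thesis using cot p by (simp add: powr_powr)
  qed
  have limC: "(C \<longlongrightarrow> 1 / sin \<theta>) (at_right 1)"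
  proof -
    have "(C \<longlongrightarrow> ((1 + (cot \<theta> powr p) powr (2 / p)) powr (p / 2)) powr (1 / p)) (at_right 1)"
      unfolding C_def using cot by (intro tendsto_intros limA) (auto simp: add_pos_nonneg less_imp_neq[symmetric])
    moreover have "((1 + (cot \<theta> powr p) powr (2 / p)) powr (p / 2)) powr (1 / p) = 1 / sin \<theta>"
    proof -
      have "(cot \<theta> powr p) powr (2 / p) = (cot \<theta>)\<^sup>2" using cot p by (simp add: powr_powr)
      then have "1 + (cot \<theta> powr p) powr (2 / p) = (1 / sin \<theta>)\<^sup>2"
        using pos sin_cos_squared_add[of \<theta>] by (simp add: cot_def power_divide field_simps)
      then show ?thesis using pos p by (simp only: square_powr_half powr_powr) simp
    qed
    ultimately show ?thesis by simp
  qed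
  have main: "hardy_norm p f \<le> ereal (C K) * hardy_norm p (\<lambda>z. Re (f z)) \<and>
      hardy_norm p (\<lambda>z. Im (f z)) \<le> ereal (c K) * hardy_norm p (\<lambda>z. Re (f z))"
    if K: "K \<ge> 1" and f: "harmonic_quasiregular K f" and f0: "\<bar>Im (f 0)\<bar> \<le> cot \<theta> * \<bar>Re (f 0)\<bar>" for K f
  proof
    note fc = harmonic_quasiregular_continuous[OF f]
    show "hardy_norm p (\<lambda>z. Im (f z)) \<le> ereal (c K) * hardy_norm p (\<lambda>z. Re (f z))"
      unfolding c_def using p A[OF K] le[OF K f f0]
      by (intro hardy_norm_le int_mean_mono) (auto simp: less_imp_le)
    show "hardy_norm p f \<le> ereal (C K) * hardy_norm p (\<lambda>z. Re (f z))"
      unfolding C_def using p Minkowski_circle[OF p A[OF K] fc _ _ le[OF K f f0]]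
      by (intro hardy_norm_le int_mean_mono) auto
  qed
  show ?thesis using limc limC main unfolding \<theta>_def by blast
qed

theorem theorem2p2:
  fixes p :: real
  assumes "2 \<le> p"
  shows
    "((\<exists>m::int. even m \<and> p = of_int m) \<longrightarrow>
       (\<exists>C c :: real \<Rightarrow> real.
          (C \<longlongrightarrow> 1 / sin (pi / (2 * p))) (at_right 1) \<and>
          (c \<longlongrightarrow> cot (pi / (2 * p))) (at_right 1) \<and>
          (\<forall>K\<ge>1. \<forall>f.
             harmonic_quasiregular K f \<and>
             (\<lambda>z. Re (f z)) \<in> harmonic_hardy p \<and>
             (\<exists>t. is_Arg (f 0) t \<and> cos (p * (t - pi / 2)) \<le> 0) \<longrightarrow>
             hardy_norm p f \<le> ereal (C K) * hardy_norm p (\<lambda>z. Re (f z)) \<and>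
             hardy_norm p (\<lambda>z. Im (f z)) \<le> ereal (c K) * hardy_norm p (\<lambda>z. Re (f z))))) \<and>
     (\<not> (\<exists>m::int. even m \<and> p = of_int m) \<longrightarrow>
       (\<exists>C c :: real \<Rightarrow> real.
          (C \<longlongrightarrow> 1 / sin (pi / (2 * p))) (at_right 1) \<and>
          (c \<longlongrightarrow> cot (pi / (2 * p))) (at_right 1) \<and>
          (\<forall>K\<ge>1. \<forall>f.
             harmonic_quasiregular K f \<and>
             (\<lambda>z. Re (f z)) \<in> harmonic_hardy p \<and>
             (\<exists>t\<in>arg_range p. is_Arg (f 0) t \<and> cos (p * (t - pi / 2)) \<le> 0) \<and>
             f ` ball 0 1 \<subseteq> D_region p \<longrightarrow>
             hardy_norm p f \<le> ereal (C K) * hardy_norm p (\<lambda>z. Re (f z)) \<and>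
             hardy_norm p (\<lambda>z. Im (f z)) \<le> ereal (c K) * hardy_norm p (\<lambda>z. Re (f z)))))"
proof -
  obtain C c :: "real \<Rightarrow> real" where lim: "(C \<longlongrightarrow> 1 / sin (pi / (2 * p))) (at_right 1)"
      "(c \<longlongrightarrow> cot (pi / (2 * p))) (at_right 1)"
    and main: "\<And>K f. K \<ge> 1 \<Longrightarrow> harmonic_quasiregular K f \<Longrightarrow> \<bar>Im (f 0)\<bar> \<le> cot (pi / (2 * p)) * \<bar>Re (f 0)\<bar> \<Longrightarrow>
      hardy_norm p f \<le> ereal (C K) * hardy_norm p (\<lambda>z. Re (f z)) \<and>
      hardy_norm p (\<lambda>z. Im (f z)) \<le> ereal (c K) * hardy_norm p (\<lambda>z. Re (f z))"
    using quasiregular_Riesz_hardy[OF assms] by blast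
  have even_case: "\<bar>Im w\<bar> \<le> cot (pi / (2 * p)) * \<bar>Re w\<bar>"
    if "even m" "p = of_int m" "is_Arg w t" "cos (p * (t - pi / 2)) \<le> 0" for m w t
    using Im_le_cot_Re[OF assms that(3)] cos_pos_of_sin_less_even[OF assms that(2,1), of "t - pi / 2"] that(4)
    by (meson not_less)
  have other_case: "\<bar>Im w\<bar> \<le> cot (pi / (2 * p)) * \<bar>Re w\<bar>"
    if t: "t \<in> arg_range p" "is_Arg w t" "cos (p * (t - pi / 2)) \<le> 0" for w t
  proof -
    \<comment> \<open>The interval \<open>arg_range p\<close> is centred at pi / 2 with radius pi -
      pi / (2 * p), the bound required by \<open>cos_pos_of_sin_less\<close>.\<close>
    have "- ((p - 1) * pi / (2 * p)) = pi / 2 - (pi - pi / (2 * p))"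
      "(3 * p - 1) * pi / (2 * p) = pi / 2 + (pi - pi / (2 * p))"
      using assms by (auto simp: field_simps)
    then have "\<bar>t - pi / 2\<bar> \<le> pi - pi / (2 * p)"
      using t(1) unfolding arg_range_def by (auto simp: abs_le_iff)
    then show ?thesis
      using Im_le_cot_Re[OF assms t(2)] cos_pos_of_sin_less[OF assms, of "t - pi / 2"] t(3)
      by (meson not_less)
  qed
  show ?thesis
  proof (intro conjI impI)
    assume "\<exists>m::int. even m \<and> p = of_int m"
    then obtain m :: int where m: "even m" "p = of_int m" by blast
    show "\<exists>C c :: real \<Rightarrow> real.
          (C \<longlongrightarrow> 1 / sin (pi / (2 * p))) (at_right 1) \<and>
          (c \<longlongrightarrow> cot (pi / (2 * p))) (at_right 1) \<and>
          (\<forall>K\<ge>1. \<forall>f.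
             harmonic_quasiregular K f \<and>
             (\<lambda>z. Re (f z)) \<in> harmonic_hardy p \<and>
             (\<exists>t. is_Arg (f 0) t \<and> cos (p * (t - pi / 2)) \<le> 0) \<longrightarrow>
             hardy_norm p f \<le> ereal (C K) * hardy_norm p (\<lambda>z. Re (f z)) \<and>
             hardy_norm p (\<lambda>z. Im (f z)) \<le> ereal (c K) * hardy_norm p (\<lambda>z. Re (f z)))"
      using lim main even_case[OF m] by (intro exI[of _ C] exI[of _ c]) blast
  next
    show "\<exists>C c :: real \<Rightarrow> real.
          (C \<longlongrightarrow> 1 / sin (pi / (2 * p))) (at_right 1) \<and>
          (c \<longlongrightarrow> cot (pi / (2 * p))) (at_right 1) \<and>
          (\<forall>K\<ge>1. \<forall>f.
             harmonic_quasiregular K f \<and>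
             (\<lambda>z. Re (f z)) \<in> harmonic_hardy p \<and>
             (\<exists>t\<in>arg_range p. is_Arg (f 0) t \<and> cos (p * (t - pi / 2)) \<le> 0) \<and>
             f ` ball 0 1 \<subseteq> D_region p \<longrightarrow>
             hardy_norm p f \<le> ereal (C K) * hardy_norm p (\<lambda>z. Re (f z)) \<and>
             hardy_norm p (\<lambda>z. Im (f z)) \<le> ereal (c K) * hardy_norm p (\<lambda>z. Re (f z)))"
      using lim main other_case by (intro exI[of _ C] exI[of _ c]) blast
  qed
qed

end
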